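(* For every $m\ge0$ and every $z\in\mathbb H$, $$c_z(\Delta,m)=\Delta(z)\Big(\frac{\pi i}{6}\Big)^m(z-\overline z)^{m+6}\sum_{r=0}^m\frac1{r!}\binom{m+11}{r+11}E_2^*(z)^{m-r}\,\mathcal B_r(z),$$ where $\mathcal B_r\in M_{2r}(\mathrm{SL}(2,\mathbb Z))$ are defined by $\mathcal B_0=1$, $\mathcal B_1=0$, and $\mathcal B_{n+1}=12\,\vartheta\mathcal B_n-n(n+11)\,E_4\,\mathcal B_{n-1}$ for $n\ge1$.
   Context: $\Delta(z)=q\prod_{n\ge1}(1-q^n)^{24}$, $q=e^{2\pi iz}$. For $z_0=\alpha+i\beta\in\mathbb H$, $\sigma_{z_0}=\frac{1}{2i\beta}\begin{pmatrix}-\overline{z_0}&z_0\\-1&1\end{pmatrix}$, $(f|_{12}\gamma)(z)=\det(\gamma)^6f(\gamma z)(cz+d)^{-12}$, and $c_{z_0}(\Delta,n)$ is defined by $(\Delta|_{12}\sigma_{z_0})(w)=\sum_{n\ge0}c_{z_0}(\Delta,n)w^n$ for $|w|<1$. $E_2(z)=1-24\sum_{n\ge1}\sigma_1(n)q^n$, $E_2^*(z)=E_2(z)-3/(\pi\,\mathrm{Im}z)$, $E_4$ is the normalized weight $4$ Eisenstein series (constant term $1$), $M_{2r}$ denotes holomorphic modular forms of weight $2r$. $\mathcal D=\frac1{2\pi i}\frac{d}{dz}$, and for $g$ of weight $k$ the Serre derivative is $\vartheta g=\mathcal Dg-\frac{k}{12}E_2\,g$ (applied to $\mathcal B_n$ with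 $k=2n$). *)

theory Defs
  imports "HOL-Complex_Analysis.Complex_Analysis"
begin

text \<open>
  Functions on the upper half-plane are total functions on \<^typ>\<open>complex\<close>; their values
  outside \<open>upper_half_plane\<close> carry no meaning.
\<close>

definition upper_half_plane :: "complex set" where
  "upper_half_plane = {z. 0 < Im z}"

definition nome :: "complex \<Rightarrow> complex" where
  "nome z = exp (2 * of_real pi * \<i> * z)"

definition divisor_power_sum :: "nat \<Rightarrow> nat \<Rightarrow> nat" where
  "divisor_power_sum k n = (\<Sum>d | d dvd n. d ^ k)"

definition Delta :: "complex \<Rightarrow> complex" where
  "Delta z = nome z * (\<Prod>n. (1 - nome z ^ Suc n) ^ 24)"

definition E2 :: "complex \<Rightarrow> complex" where
  "E2 z = 1 - 24 * (\<Sum>n. of_nat (divisor_power_sum 1 (Suc n)) * nome z ^ Suc n)"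

definition E4 :: "complex \<Rightarrow> complex" where
  "E4 z = 1 + 240 * (\<Sum>n. of_nat (divisor_power_sum 3 (Suc n)) * nome z ^ Suc n)"

definition E2_star :: "complex \<Rightarrow> complex" where
  "E2_star z = E2 z - 3 / of_real (pi * Im z)"

definition D_op :: "(complex \<Rightarrow> complex) \<Rightarrow> complex \<Rightarrow> complex" where
  "D_op f z = 1 / (2 * of_real pi * \<i>) * deriv f z"

definition serre_deriv :: "nat \<Rightarrow> (complex \<Rightarrow> complex) \<Rightarrow> complex \<Rightarrow> complex" where
  "serre_deriv k g z = D_op g z - of_nat k / 12 * E2 z * g z"

text \<open>
  Holomorphic modular forms of weight \<open>k\<close> for the full modular group. Holomorphy at the cusp is
  the existence of a \<open>q\<close>-expansion without negative powers, converging on the whole half-plane.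
\<close>

definition modular_forms :: "nat \<Rightarrow> (complex \<Rightarrow> complex) set" where
  "modular_forms k = {f.
     f holomorphic_on upper_half_plane \<and>
     (\<forall>a b c d :: int. a * d - b * c = 1 \<longrightarrow>
        (\<forall>z\<in>upper_half_plane.
           f ((of_int a * z + of_int b) / (of_int c * z + of_int d)) =
             (of_int c * z + of_int d) ^ k * f z)) \<and>
     (\<exists>s :: nat \<Rightarrow> complex. \<forall>z\<in>upper_half_plane. (\<lambda>n. s n * nome z ^ n) sums f z)}"

definition slash12 :: "(complex \<Rightarrow> complex) \<Rightarrow> complex^2^2 \<Rightarrow> complex \<Rightarrow> complex" where
  "slash12 f \<gamma> z =
     det \<gamma> ^ 6 * f ((\<gamma>$1$1 * z + \<gamma>$1$2) / (\<gamma>$2$1 * z + \<gamma>$2$2))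
       * (\<gamma>$2$1 * z + \<gamma>$2$2) powi (-12)"

definition sigma_mat :: "complex \<Rightarrow> complex^2^2" where
  "sigma_mat z0 =
     map_matrix (\<lambda>x. 1 / (2 * \<i> * of_real (Im z0)) * x)
       (vector [vector [- cnj z0, z0],
                vector [-1,       1 ]])"

text \<open>
  The sequence of Taylor coefficients of \<open>f|\<^sub>1\<^sub>2\<sigma>\<^sub>z\<^sub>0\<close> on the unit disc, as a definite
  description: such a sequence is unique whenever it exists, and it exists for \<open>f\<close> holomorphic
  on the upper half-plane and \<open>z\<^sub>0\<close> in it.
\<close>

definition taylor_coeff12 :: "complex \<Rightarrow> (complex \<Rightarrow> complex) \<Rightarrow> nat \<Rightarrow> complex" where
  "taylor_coeff12 z0 f =
     (THE c. \<forall>w. norm w < 1 \<longrightarrow> (\<lambda>n. c n * w ^ n) sums slash12 f (sigma_mat z0) w)"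

text \<open>
  The last equation is the recursion \<open>B\<^sub>n\<^sub>+\<^sub>1 = 12 \<vartheta>B\<^sub>n - n(n + 11) E\<^sub>4 B\<^sub>n\<^sub>-\<^sub>1\<close> at index
  \<open>n + 1\<close>, the Serre derivative being taken in weight \<open>2(n + 1)\<close>.
\<close>

fun calB :: "nat \<Rightarrow> complex \<Rightarrow> complex" where
  "calB 0 = (\<lambda>z. 1)"
| "calB (Suc 0) = (\<lambda>z. 0)"
| "calB (Suc (Suc n)) =
     (\<lambda>z. 12 * serre_deriv (2 * (n + 1)) (calB (Suc n)) z
          - of_nat ((n + 1) * (n + 12)) * E4 z * calB n z)"

end

theory Submission
  imports Defs
begin

text \<open>
  Everything rests on three facts: \<open>D \<Delta> = E\<^sub>2 \<Delta>\<close>, Ramanujan's \<open>12 D E\<^sub>2 = E\<^sub>2\<^sup>2 - E\<^sub>4\<close>, and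
  \<open>E\<^sub>2(-1/z) = z\<^sup>2 E\<^sub>2(z) + 6 z / (\<pi> \<i>)\<close>. Ramanujan's identity is equivalent to the convolution formula
  for \<open>\<sigma>\<^sub>1\<close>, which follows from bijections between the positive solutions of \<open>a x + b y = n\<close>. It also
  reduces the modularity of \<open>E\<^sub>4\<close> to the inversion formula of \<open>E\<^sub>2\<close>, so that no Eisenstein series
  of weight \<open>4\<close> over a lattice is needed. The inversion formula is Eisenstein's summation: the row and the column sums of
  \<open>1 / (c z + d)\<^sup>2\<close> are compared by subtracting the telescoping terms
  \<open>1 / (c z + d - 1/2) - 1 / (c z + d + 1/2)\<close>, which makes the double series absolutely convergent.

  With \<open>a(n,j) = n!/j! (n + 11 choose j + 11)\<close>, the first two facts and the recursion of \<open>\<B>\<^sub>r\<close> give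
  \<open>12\<^sup>n D\<^sup>n \<Delta> = \<Delta> (\<Sum>r\<le>n. a(n,r) E\<^sub>2\<^bsup>n-r\<^esup> \<B>\<^sub>r)\<close>, while the
  \<open>n\<close>-th Taylor coefficient of \<open>\<Delta>\<close> slashed with the Cayley matrix is a combination of the derivatives
  \<open>\<Delta>\<^bsup>(j)\<^esup>(z)\<close> with the same weights \<open>a(n,j)\<close>. Both are instances of the recurrence
  \<open>a(n+1,j) = (n + j + 12) a(n,j) + a(n,j-1)\<close>. In the combined sum, the binomial theorem turns \<open>E\<^sub>2\<close> into
  \<open>E\<^sub>2\<^sup>*\<close>, because \<open>\<pi> \<i>/6 (z - cnj z) E\<^sub>2\<^sup>* = \<pi> \<i>/6 (z - cnj z) E\<^sub>2 + 1\<close>.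
\<close>

subsection \<open>Convolution of divisor sums\<close>

definition quads :: "nat \<Rightarrow> (nat \<times> nat \<times> nat \<times> nat) set" where
  "quads n = {(a, b, x, y). 0 < a \<and> 0 < b \<and> 0 < x \<and> 0 < y \<and> a * x + b * y = n}"

lemma finite_quads [simp]: "finite (quads n)"
proof (rule finite_subset)
  show "quads n \<subseteq> {..n} \<times> {..n} \<times> {..n} \<times> {..n}"
    by (auto simp: quads_def dest!: gr0_implies_Suc)
qed auto

lemma sum_quads_swap:
  "(\<Sum>(a, b, x, y)\<in>quads n. h a b x y) = (\<Sum>(a, b, x, y)\<in>quads n. h b a y x)"
  by (rule sum.reindex_bij_witness[where i = "\<lambda>(a, b, x, y). (b, a, y, x)"
        and j = "\<lambda>(a, b, x, y). (b, a, y, x)"]) (auto simp: quads_def add.commute)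

lemma sum_quads_split:
  fixes h :: "nat \<Rightarrow> nat \<Rightarrow> nat \<Rightarrow> nat \<Rightarrow> 'a :: comm_monoid_add"
  assumes "\<And>a b x y. P a b x y \<or> P' a b x y \<or> P'' a b x y"
    and "\<And>a b x y. \<not> (P a b x y \<and> P' a b x y)" "\<And>a b x y. \<not> (P a b x y \<and> P'' a b x y)"
        "\<And>a b x y. \<not> (P' a b x y \<and> P'' a b x y)"
  shows "(\<Sum>(a, b, x, y)\<in>quads n. h a b x y) =
    (\<Sum>(a, b, x, y)\<in>quads n. if P a b x y then h a b x y else 0) +
    (\<Sum>(a, b, x, y)\<in>quads n. if P' a b x y then h a b x y else 0) +
    (\<Sum>(a, b, x, y)\<in>quads n. if P'' a b x y then h a b x y else 0)"
  unfolding sum.distrib[symmetric]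
proof (rule sum.cong[OF refl], clarify, goal_cases)
  case (1 a b x y)
  show ?case using assms[of a b x y] by auto
qed

text \<open>The regions stay \<open>if\<close> conditions under one sum over \<open>quads n\<close>,
  so that splitting, swapping and change of variables can be chained.\<close>

lemma sum_quads_reindex:
  fixes h h' :: "nat \<Rightarrow> nat \<Rightarrow> nat \<Rightarrow> nat \<Rightarrow> 'a :: comm_monoid_add"
  assumes "\<And>a b x y. (a, b, x, y) \<in> quads n \<Longrightarrow> P a b x y \<Longrightarrow>
      i (j (a, b, x, y)) = (a, b, x, y) \<and> j (a, b, x, y) \<in> quads n \<inter> {(a, b, x, y). P' a b x y}"
    and "\<And>a b x y. (a, b, x, y) \<in> quads n \<Longrightarrow> P' a b x y \<Longrightarrow>
      j (i (a, b, x, y)) = (a, b, x, y) \<and> i (a, b, x, y) \<in> quads n \<inter> {(a, b, x, y). P a b x y}"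
    and "\<And>a b x y. (a, b, x, y) \<in> quads n \<Longrightarrow> P a b x y \<Longrightarrow>
      (case j (a, b, x, y) of (a, b, x, y) \<Rightarrow> h' a b x y) = h a b x y"
  shows "(\<Sum>(a, b, x, y)\<in>quads n. if P a b x y then h a b x y else 0) =
    (\<Sum>(a, b, x, y)\<in>quads n. if P' a b x y then h' a b x y else 0)"
proof -
  have *: "(\<Sum>(a, b, x, y)\<in>quads n. if R a b x y then g a b x y else 0) =
      (\<Sum>(a, b, x, y)\<in>quads n \<inter> {(a, b, x, y). R a b x y}. g a b x y)"
    for R and g :: "nat \<Rightarrow> nat \<Rightarrow> nat \<Rightarrow> nat \<Rightarrow> 'a"
    by (subst sum.inter_restrict, simp, rule sum.cong) auto
  show ?thesis
    unfolding *
  proof (rule sum.reindex_bij_witness[where i = i and j = j], goal_cases)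
    case (1 q)
    then show ?case using assms(1) by (cases q) auto
  next
    case (2 q)
    obtain a b x y where "q = (a, b, x, y)" by (cases q)
    then show ?case using assms(1)[of a b x y] 2 by simp
  next
    case (3 q)
    then show ?case using assms(2) by (cases q) auto
  next
    case (4 q)
    obtain a b x y where "q = (a, b, x, y)" by (cases q)
    then show ?case using assms(2)[of a b x y] 4 by simp
  next
    case (5 q)
    then show ?case using assms(3) by (cases q) auto
  qed
qed

text \<open>For \<open>x = y\<close> the equation is \<open>(a + b) * x = n\<close>, so
  \<open>d = a + b\<close> runs through the divisors of \<open>n\<close> and \<open>a\<close> is
  free below \<open>d\<close>.\<close>

lemma sum_quads_diagonal:
  fixes f :: "nat \<Rightarrow> 'a :: comm_monoid_add"
  assumes "0 < n"
  shows "(\<Sum>(a, b, x, y)\<in>quads n. if x = y then h a b else 0) =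
    (\<Sum>d | d dvd n. \<Sum>a\<in>{0<..<d}. h a (d - a))"
proof -
  have "(\<Sum>(a, b, x, y)\<in>quads n. if x = y then h a b else 0) =
      (\<Sum>(a, b, x, y)\<in>quads n \<inter> {(a, b, x, y). x = y}. h a b)"
    by (subst sum.inter_restrict, simp, rule sum.cong) auto
  also have "\<dots> = (\<Sum>(d, a)\<in>Sigma {d. d dvd n} (\<lambda>d. {0<..<d}). h a (d - a))"
    by (rule sum.reindex_bij_witness[where i = "\<lambda>(d, a). (a, d - a, n div d, n div d)"
          and j = "\<lambda>(a, b, x, y). (a + b, a)"])
       (use assms in \<open>auto simp: quads_def add_mult_distrib [symmetric] dvd_div_eq_0_iff
          intro!: Nat.gr0I\<close>)
  also have "\<dots> = (\<Sum>d | d dvd n. \<Sum>a\<in>{0<..<d}. h a (d - a))"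
    by (subst sum.Sigma) (use assms in auto)
  finally show ?thesis .
qed

text \<open>For \<open>a = b\<close> the equation is \<open>a * (x + y) = n\<close>; a divisor
  \<open>d = a\<close> leaves \<open>n div d - 1\<close> ways of writing \<open>n div d\<close> as
  \<open>x + y\<close>.\<close>

lemma sum_quads_diagonal':
  assumes "0 < n"
  shows "(\<Sum>(a, b, x, y)\<in>quads n. if a = b then h b else 0) =
    (\<Sum>d | d dvd n. of_nat (n div d - 1) * (h d :: 'a :: comm_semiring_1))"
proof -
  have "(\<Sum>(a, b, x, y)\<in>quads n. if a = b then h b else 0) =
      (\<Sum>(a, b, x, y)\<in>quads n \<inter> {(a, b, x, y). a = b}. h b)"
    by (subst sum.inter_restrict, simp, rule sum.cong) auto
  also have "\<dots> = (\<Sum>(d, x)\<in>Sigma {d. d dvd n} (\<lambda>d. {0<..<n div d}). h d)"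
  proof (rule sum.reindex_bij_witness[where i = "\<lambda>(d, x). (d, d, x, n div d - x)"
          and j = "\<lambda>(a, b, x, y). (a, x)"], goal_cases)
    case (1 q)
    then obtain a x y where q: "q = (a, a, x, y)" "0 < a" "0 < x" "0 < y" "n = a * (x + y)"
      by (auto simp: quads_def add_mult_distrib2)
    then show ?case by simp
  next
    case (2 q)
    then obtain a x y where q: "q = (a, a, x, y)" "0 < a" "0 < x" "0 < y" "n = a * (x + y)"
      by (auto simp: quads_def add_mult_distrib2)
    then show ?case by simp
  next
    case (3 p)
    then show ?case by auto
  next
    case (4 p)
    then obtain d x where p: "p = (d, x)" "d dvd n" "0 < x" "x < n div d" by auto
    have "d * x + d * (n div d - x) = n"
      using p by (simp add: add_mult_distrib2 [symmetric])
    moreover have "0 < d" using p assms by (auto intro!: Nat.gr0I)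
    ultimately show ?case using p by (simp add: quads_def)
  qed auto
  also have "\<dots> = (\<Sum>d | d dvd n. \<Sum>x\<in>{0<..<n div d}. h d)"
    by (subst sum.Sigma) (use assms in auto)
  finally show ?thesis by simp
qed

text \<open>The shear \<open>a x + b y = a (x + y) + (b - a) y\<close> carries the region
  \<open>a < b\<close> to \<open>y < x\<close>. Off the diagonals it turns the two sums on the left
  into twice \<open>X\<close> and twice \<open>A\<close>, both sums of \<open>f b\<close>. Splitting
  the sum of \<open>f b\<close> over \<open>quads n\<close> once by \<open>a, b\<close> and once by
  \<open>x, y\<close> expresses \<open>A - X\<close> through the diagonals, which are divisor
  sums.\<close>

lemma liouville_identity:
  fixes f :: "nat \<Rightarrow> 'a :: comm_ring_1"
  assumes n: "0 < n"
  shows "(\<Sum>(a, b, x, y)\<in>quads n. f (if a < b then b - a else a - b) - f (a + b)) =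
    (\<Sum>d | d dvd n. of_nat (n div d - 1) * f 0 + 2 * of_nat (n div d - 1) * f d
      - of_nat (d - 1) * f d - 2 * (\<Sum>l\<in>{0<..<d}. f l))"
proof -
  define S where "S P h = (\<Sum>(a, b, x, y)\<in>quads n. if P a b x y then (h a b x y :: 'a) else 0)" for P h
  note split_ab = sum_quads_split[where P = "\<lambda>a b x y. a < b" and P' = "\<lambda>a b x y. a = b"
      and P'' = "\<lambda>a b x y. b < a" and n = n, folded S_def]
  note split_xy = sum_quads_split[where P = "\<lambda>a b x y. x < y" and P' = "\<lambda>a b x y. x = y"
      and P'' = "\<lambda>a b x y. y < x" and n = n, folded S_def]
  define A where "A = S (\<lambda>a b x y. a < b) (\<lambda>a b x y. f b)"
  define X where "X = S (\<lambda>a b x y. y < x) (\<lambda>a b x y. f b)"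
  have "S (\<lambda>a b x y. a < b) (\<lambda>a b x y. f (b - a)) = X"
    unfolding S_def X_def
    by (rule sum_quads_reindex[where j = "\<lambda>(a, b, x, y). (a, b - a, x + y, y)"
          and i = "\<lambda>(a, b, x, y). (a, a + b, x - y, y)"])
       (auto simp: quads_def algebra_simps dest!: less_imp_Suc_add)
  moreover have "S (\<lambda>a b x y. b < a) (\<lambda>a b x y. f (a - b)) =
      S (\<lambda>a b x y. a < b) (\<lambda>a b x y. f (b - a))"
    unfolding S_def by (rule sum_quads_swap)
  moreover have "S (\<lambda>a b x y. y < x) (\<lambda>a b x y. f (a + b)) = A"
    unfolding S_def A_def
    by (rule sum_quads_reindex[where i = "\<lambda>(a, b, x, y). (a, b - a, x + y, y)"
          and j = "\<lambda>(a, b, x, y). (a, a + b, x - y, y)"])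
       (auto simp: quads_def algebra_simps dest!: less_imp_Suc_add)
  moreover have "S (\<lambda>a b x y. x < y) (\<lambda>a b x y. f (a + b)) =
      S (\<lambda>a b x y. y < x) (\<lambda>a b x y. f (a + b))"
    unfolding S_def by (subst sum_quads_swap) (intro sum.cong refl, auto simp: add.commute)
  \<comment> \<open>These two parts cancel when the two splittings of the sum of \<open>f b\<close>
    are equated.\<close>
  moreover have "S (\<lambda>a b x y. b < a) (\<lambda>a b x y. f b) = S (\<lambda>a b x y. x < y) (\<lambda>a b x y. f b)"
    unfolding S_def
    by (rule sum_quads_reindex[where j = "\<lambda>(a, b, x, y). (a - b, b, x, x + y)"
          and i = "\<lambda>(a, b, x, y). (a + b, b, x, y - x)"])
       (auto simp: quads_def algebra_simps dest!: less_imp_Suc_add)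
  moreover have "S (\<lambda>a b x y. x = y) (\<lambda>a b x y. f b) = (\<Sum>d | d dvd n. \<Sum>l\<in>{0<..<d}. f l)"
    unfolding S_def sum_quads_diagonal[OF n]
    by (intro sum.cong refl sum.reindex_bij_witness[where i = "\<lambda>l. d - l" and j = "\<lambda>l. d - l" for d]) auto
  moreover have "S (\<lambda>a b x y. x = y) (\<lambda>a b x y. f (a + b)) = (\<Sum>d | d dvd n. of_nat (d - 1) * f d)"
    unfolding S_def sum_quads_diagonal[OF n] by (intro sum.cong refl) simp
  moreover have "S (\<lambda>a b x y. a = b) (\<lambda>a b x y. h b) = (\<Sum>d | d dvd n. of_nat (n div d - 1) * h d)"
    for h :: "nat \<Rightarrow> 'a"
    unfolding S_def by (rule sum_quads_diagonal'[OF n])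
  moreover have "(\<Sum>(a, b, x, y)\<in>quads n. f (if a < b then b - a else a - b)) =
      S (\<lambda>a b x y. a < b) (\<lambda>a b x y. f (b - a)) + S (\<lambda>a b x y. a = b) (\<lambda>a b x y. f 0)
      + S (\<lambda>a b x y. b < a) (\<lambda>a b x y. f (a - b))"
    by (subst split_ab) (auto simp: S_def intro!: sum.cong arg_cong2[where f = "(+)"])
  moreover have "(\<Sum>(a, b, x, y)\<in>quads n. f (a + b)) =
      S (\<lambda>a b x y. x < y) (\<lambda>a b x y. f (a + b)) + S (\<lambda>a b x y. x = y) (\<lambda>a b x y. f (a + b))
      + S (\<lambda>a b x y. y < x) (\<lambda>a b x y. f (a + b))"
    by (subst split_xy) (auto simp: S_def)
  moreover have "(\<Sum>(a, b, x, y)\<in>quads n. f b) =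
      A + S (\<lambda>a b x y. a = b) (\<lambda>a b x y. f b) + S (\<lambda>a b x y. b < a) (\<lambda>a b x y. f b)"
    unfolding A_def by (subst split_ab) (auto simp: S_def)
  moreover have "(\<Sum>(a, b, x, y)\<in>quads n. f b) =
      S (\<lambda>a b x y. x < y) (\<lambda>a b x y. f b) + S (\<lambda>a b x y. x = y) (\<lambda>a b x y. f b) + X"
    unfolding X_def by (subst split_xy) (auto simp: S_def)
  ultimately have
    "A = X + (\<Sum>d | d dvd n. \<Sum>l\<in>{0<..<d}. f l) - (\<Sum>d | d dvd n. of_nat (n div d - 1) * f d)"
    "(\<Sum>(a, b, x, y)\<in>quads n. f (if a < b then b - a else a - b) - f (a + b)) =
      2 * X + (\<Sum>d | d dvd n. of_nat (n div d - 1) * f 0) - 2 * A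
      - (\<Sum>d | d dvd n. of_nat (d - 1) * f d)"
    by (simp_all add: sum_subtractf case_prod_unfold algebra_simps)
  then show ?thesis
    by (simp add: sum_subtractf sum.distrib flip: sum_distrib_left) (simp add: mult.assoc sum_distrib_left algebra_simps)
qed

lemma sum_squares_below: "6 * (\<Sum>l\<in>{0<..<d}. (int l)\<^sup>2) = 2 * int d ^ 3 - 3 * int d ^ 2 + int d"
proof (induction d)
  case (Suc d)
  have "(\<Sum>l\<in>{0<..<Suc d}. (int l)\<^sup>2) = (\<Sum>l\<in>{0<..<d}. (int l)\<^sup>2) + (int d)\<^sup>2"
  proof (cases "d = 0")
    case False
    then have "{0<..<Suc d} = insert d {0<..<d}" by auto
    then show ?thesis by simp
  qed auto
  with Suc.IH show ?case by (simp add: algebra_simps power2_eq_square power3_eq_cube)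
qed auto

text \<open>Put \<open>k = a * x\<close>: then \<open>a\<close> divides \<open>k\<close>,
  \<open>b\<close> divides \<open>n - k\<close>, and the cofactors \<open>x\<close>,
  \<open>y\<close> are determined.\<close>

lemma sum_quads_convolution:
  "(\<Sum>(a, b, x, y)\<in>quads n. int (a * b)) =
    (\<Sum>k\<in>{0<..<n}. int (divisor_power_sum 1 k * divisor_power_sum 1 (n - k)))"
proof -
  have "(\<Sum>(a, b, x, y)\<in>quads n. int (a * b)) =
      (\<Sum>(k, a, b)\<in>Sigma {0<..<n} (\<lambda>k. {d. d dvd k} \<times> {d. d dvd (n - k)}). int (a * b))"
    by (rule sum.reindex_bij_witness[where j = "\<lambda>(a, b, x, y). (a * x, a, b)"
          and i = "\<lambda>(k, a, b). (a, b, k div a, (n - k) div b)"])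
       (auto simp: quads_def dvd_div_eq_0_iff intro!: Nat.gr0I)
  also have "\<dots> = (\<Sum>k\<in>{0<..<n}. \<Sum>(a, b)\<in>{d. d dvd k} \<times> {d. d dvd (n - k)}. int (a * b))"
    by (subst sum.Sigma) auto
  also have "\<dots> = (\<Sum>k\<in>{0<..<n}. int (divisor_power_sum 1 k * divisor_power_sum 1 (n - k)))"
    by (intro sum.cong refl) (simp add: divisor_power_sum_def sum_product sum.cartesian_product case_prod_unfold)
  finally show ?thesis .
qed

text \<open>Liouville's identity for \<open>f k = k^2\<close>: since
  \<open>(a - b)^2 - (a + b)^2 = - 4 a b\<close>, its left side is a multiple of the
  convolution.\<close>

lemma divisor_sum_convolution:
  assumes n: "0 < n"
  shows "12 * (\<Sum>k\<in>{0<..<n}. int (divisor_power_sum 1 k * divisor_power_sum 1 (n - k))) =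
    5 * int (divisor_power_sum 3 n) + int (divisor_power_sum 1 n)
    - 6 * int n * int (divisor_power_sum 1 n)"
proof -
  define q where "q a b = (int (if a < b then b - a else a - b))\<^sup>2 - (int (a + b))\<^sup>2" for a b
  have q: "q a b = -4 * int (a * b)" for a b
    by (auto simp: q_def power2_eq_square algebra_simps of_nat_diff)
  \<comment> \<open>The factor 3 allows \<open>sum_squares_below\<close>, which evaluates six times
    the sum of squares, to be used without division.\<close>
  have "-12 * (\<Sum>(a, b, x, y)\<in>quads n. int (a * b)) = 3 * (\<Sum>(a, b, x, y)\<in>quads n. q a b)"
    unfolding sum_distrib_left by (intro sum.cong) (auto simp: q)
  also have "\<dots> = (\<Sum>d | d dvd n. 3 * (of_nat (n div d - 1) * (int 0)\<^sup>2
      + 2 * of_nat (n div d - 1) * (int d)\<^sup>2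
      - of_nat (d - 1) * (int d)\<^sup>2 - 2 * (\<Sum>l\<in>{0<..<d}. (int l)\<^sup>2)))"
    unfolding q_def liouville_identity[OF n, where f = "\<lambda>k. (int k)\<^sup>2"] sum_distrib_left ..
  also have "\<dots> = (\<Sum>d | d dvd n. 6 * int n * int d - 5 * int d ^ 3 - int d)"
  proof (rule sum.cong[OF refl])
    fix d assume "d \<in> {d. d dvd n}"
    then obtain e where e: "n = d * e" by auto
    with n have "0 < d" "0 < e" by auto
    then have "int (n div d - 1) = int e - 1" "int (d - 1) = int d - 1"
      using e by (simp_all add: of_nat_diff)
    then show "3 * (of_nat (n div d - 1) * (int 0)\<^sup>2 + 2 * of_nat (n div d - 1) * (int d)\<^sup>2
      - of_nat (d - 1) * (int d)\<^sup>2 - 2 * (\<Sum>l\<in>{0<..<d}. (int l)\<^sup>2)) =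
        6 * int n * int d - 5 * int d ^ 3 - int d"
      using sum_squares_below[of d] e by (simp add: algebra_simps power2_eq_square power3_eq_cube)
  qed
  also have "\<dots> = 6 * int n * int (divisor_power_sum 1 n) - 5 * int (divisor_power_sum 3 n)
      - int (divisor_power_sum 1 n)"
    by (simp add: divisor_power_sum_def sum_subtractf sum_distrib_left)
  finally show ?thesis
    unfolding sum_quads_convolution by linarith
qed

subsection \<open>The nome\<close>

lemma nome_add_1: "nome (z + 1) = nome z"
  by (simp add: nome_def exp_add ring_distribs mult.commute)

lemma norm_nome_less_1: "z \<in> upper_half_plane \<Longrightarrow> norm (nome z) < 1"
  by (simp add: nome_def upper_half_plane_def)

lemma nome_mult_of_nat: "nome (of_nat c * z) = nome z ^ c"
  by (simp add: nome_def exp_of_nat_mult [symmetric] mult_ac)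

lemma open_upper_half_plane: "open upper_half_plane"
  unfolding upper_half_plane_def by (simp add: open_halfspace_Im_gt)

lemma nome_has_field_derivative [derivative_intros]:
  assumes "(g has_field_derivative g') (at z within A)"
  shows "((\<lambda>z. nome (g z)) has_field_derivative 2 * of_real pi * \<i> * nome (g z) * g') (at z within A)"
  unfolding nome_def by (auto intro!: derivative_eq_intros assms)

subsection \<open>Lambert series\<close>

text \<open>One absolutely convergent double sum, to be summed by rows, by columns, or along
  \<open>n * c\<close> constant.\<close>

definition lambert :: "nat \<Rightarrow> complex \<Rightarrow> complex" where
  "lambert k q = (\<Sum>\<^sub>\<infinity>(n, c)\<in>{1..}\<times>{1..}. of_nat n ^ k * q ^ (n * c))"

lemma summable_nat_power_mult_geometric:
  fixes r :: real
  assumes "0 \<le> r" "r < 1"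
  shows "summable (\<lambda>n. of_nat n ^ k * r ^ n)"
proof (rule summable_in_conv_radius)
  have "conv_radius (\<lambda>n. of_nat n ^ k :: real) = 1"
    by (rule conv_radius_ratio_limit_nonzero[where c' = 1])
       (auto simp: field_simps eventually_at_top_linorder, real_asymp)
  then show "ereal (norm r) < conv_radius (\<lambda>n. of_nat n ^ k :: real)"
    using assms by simp
qed

text \<open>The rows are geometric, and \<open>1 - r ^ n\<close> is at least \<open>1 - r\<close>,
  so the row sums are dominated by a multiple of \<open>n ^ k * r ^ n\<close>.\<close>

lemma lambert_summable:
  fixes q :: complex
  assumes q: "norm q < 1"
  shows "(\<lambda>(n, c). of_nat n ^ k * q ^ (n * c)) summable_on {1..}\<times>{1..}"
proof -
  define r where "r = norm q"
  have r: "0 \<le> r" "r < 1" using q by (auto simp: r_def)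
  have "(\<lambda>(n, c). of_nat n ^ k * r ^ (n * c)) summable_on {1..}\<times>{1..}"
  proof (rule summable_on_SigmaI)
    fix n :: nat assume "n \<in> {1..}"
    then have "norm (r ^ n) < 1" using r by (auto intro: power_Suc_less_one simp: power_less_one_iff)
    then have "((\<lambda>c. (r ^ n) ^ c) has_sum (r ^ n / (1 - r ^ n))) {1..}"
      by (rule has_sum_geometric_from_1)
    from has_sum_cmult_right[OF this, of "of_nat n ^ k"]
    show "((\<lambda>c. case (n, c) of (n, c) \<Rightarrow> of_nat n ^ k * r ^ (n * c)) has_sum
        (of_nat n ^ k * (r ^ n / (1 - r ^ n)))) {1..}"
      by (simp add: power_mult)
  next
    have "(\<lambda>n. of_nat n ^ k * r ^ n * (1 / (1 - r))) summable_on UNIV"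
      by (rule summable_on_cmult_left, rule summable_nonneg_imp_summable_on)
         (use r summable_nat_power_mult_geometric in auto)
    then have *: "(\<lambda>n. of_nat n ^ k * r ^ n * (1 / (1 - r))) summable_on {1..}"
      by (rule summable_on_subset) auto
    show "(\<lambda>n. of_nat n ^ k * (r ^ n / (1 - r ^ n))) summable_on {1..}"
    proof (rule summable_on_comparison_test[OF *])
      fix n :: nat assume "n \<in> {1..}"
      then have "r ^ n \<le> r ^ 1" using r by (intro power_decreasing) auto
      then show "of_nat n ^ k * (r ^ n / (1 - r ^ n)) \<le> of_nat n ^ k * r ^ n * (1 / (1 - r))"
        using r by (auto intro!: mult_left_mono divide_left_mono mult_pos_pos simp: mult.assoc divide_inverse)
      show "0 \<le> of_nat n ^ k * (r ^ n / (1 - r ^ n))"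
        using r by (simp add: power_le_one)
    qed
  qed (use r in auto)
  then have "(\<lambda>x. norm (case x of (n, c) \<Rightarrow> of_nat n ^ k * q ^ (n * c))) summable_on {1..}\<times>{1..}"
    by (rule Infinite_Sum.abs_summable_on_comparison_test') (auto simp: r_def norm_mult norm_power)
  then show ?thesis
    by (rule abs_summable_summable)
qed

lemma lambert_has_sum:
  assumes "norm q < 1"
  shows "((\<lambda>(n, c). of_nat n ^ k * q ^ (n * c)) has_sum lambert k q) ({1..}\<times>{1..})"
  using lambert_summable[OF assms, of k] unfolding lambert_def by (rule has_sum_infsum)

text \<open>Summation over \<open>c\<close> first. For \<open>k = 1\<close> these terms come from
  the logarithmic derivative of Euler's product.\<close>

lemma lambert_has_sum_rows:
  assumes "norm q < 1"
  shows "((\<lambda>n. of_nat n ^ k * (q ^ n / (1 - q ^ n))) has_sum lambert k q) {1..}"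
proof (rule has_sum_SigmaD[OF lambert_has_sum[OF assms]])
  fix n :: nat assume "n \<in> {1..}"
  then have "norm (q ^ n) < 1" using assms by (auto simp: norm_power power_less_one_iff)
  then have "((\<lambda>c. (q ^ n) ^ c) has_sum (q ^ n / (1 - q ^ n))) {1..}"
    by (rule has_sum_geometric_from_1)
  from has_sum_cmult_right[OF this, of "of_nat n ^ k"]
  show "((\<lambda>c. case (n, c) of (n, c) \<Rightarrow> of_nat n ^ k * q ^ (n * c)) has_sum
      (of_nat n ^ k * (q ^ n / (1 - q ^ n)))) {1..}"
    by (simp add: power_mult)
qed

lemma has_sum_nat_mult_geometric:
  fixes q :: complex
  assumes "norm q < 1"
  shows "((\<lambda>n. of_nat n * q ^ n) has_sum (q / (1 - q)\<^sup>2)) {1..}"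
proof -
  have "(\<lambda>n. of_nat (Suc n) * q ^ n) sums (1 / (1 - q)\<^sup>2)"
    by (rule geometric_deriv_sums[OF assms])
  from sums_mult[OF this, of q] have "(\<lambda>n. of_nat (Suc n) * q ^ Suc n) sums (q / (1 - q)\<^sup>2)"
    by (simp add: mult_ac)
  then have *: "(\<lambda>n. of_nat n * q ^ n) sums (q / (1 - q)\<^sup>2)"
    using sums_Suc_iff[of "\<lambda>n. of_nat n * q ^ n"] by simp
  have "summable (\<lambda>n. norm (of_nat n * q ^ n))"
    using summable_nat_power_mult_geometric[of "norm q" 1] assms by (simp add: norm_mult norm_power)
  then have "((\<lambda>n. of_nat n * q ^ n) has_sum (q / (1 - q)\<^sup>2)) UNIV"
    using * by (rule norm_summable_imp_has_sum)
  then show ?thesis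
    by (rule has_sum_cong_neutral[THEN iffD1, rotated -1]) auto
qed

text \<open>Summation over \<open>n\<close> first. At the nome these terms are, up to a constant,
  \<open>pi^2 / sin^2\<close>, that is, Eisenstein's row sums.\<close>

lemma lambert_has_sum_columns:
  assumes "norm q < 1"
  shows "((\<lambda>c. q ^ c / (1 - q ^ c)\<^sup>2) has_sum lambert 1 q) {1..}"
proof (rule has_sum_SigmaD)
  show "((\<lambda>(c, n). of_nat n * q ^ (n * c)) has_sum lambert 1 q) ({1..}\<times>{1..})"
    using lambert_has_sum[OF assms, of 1] by (subst (asm) has_sum_swap) (simp add: case_prod_unfold)
next
  fix c :: nat assume "c \<in> {1..}"
  then have "norm (q ^ c) < 1" using assms by (auto simp: norm_power power_less_one_iff)
  from has_sum_nat_mult_geometric[OF this]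
  show "((\<lambda>n. case (c, n) of (c, n) \<Rightarrow> of_nat n * q ^ (n * c)) has_sum (q ^ c / (1 - q ^ c)\<^sup>2)) {1..}"
    by (simp flip: power_mult add: mult.commute)
qed

text \<open>The pairs are grouped by their product, which gives the coefficients in the definitions
  of \<open>E2\<close> and \<open>E4\<close>.\<close>

lemma lambert_has_sum_divisors:
  assumes "norm q < 1"
  shows "((\<lambda>n. of_nat (divisor_power_sum k n) * q ^ n) has_sum lambert k q) {1..}"
proof (rule has_sum_SigmaD)
  have "bij_betw (\<lambda>(n, d). (d, n div d)) (Sigma {1::nat..} (\<lambda>n. {d. d dvd n})) ({1..}\<times>{1..})"
    by (rule bij_betwI[where g = "\<lambda>(d, c). (d * c, d)"])
       (auto simp: dvd_div_eq_0_iff Suc_le_eq intro!: Nat.gr0I)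
  from has_sum_reindex_bij_betw[OF this, THEN iffD2, OF lambert_has_sum[OF assms]]
  have "((\<lambda>(n, d). of_nat d ^ k * q ^ (d * (n div d))) has_sum lambert k q) (Sigma {1..} (\<lambda>n. {d. d dvd n}))"
    by (simp add: case_prod_unfold)
  then show "((\<lambda>(n, d). of_nat d ^ k * q ^ n) has_sum lambert k q) (Sigma {1..} (\<lambda>n. {d. d dvd n}))"
    by (rule has_sum_cong[THEN iffD1, rotated]) auto
next
  fix n :: nat assume "n \<in> {1..}"
  then show "((\<lambda>d. case (n, d) of (n, d) \<Rightarrow> of_nat d ^ k * q ^ n) has_sum
      of_nat (divisor_power_sum k n) * q ^ n) {d. d dvd n}"
    by (intro has_sum_finiteI) (auto simp: divisor_power_sum_def sum_distrib_right)
qed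

text \<open>The set of divisors of \<open>0\<close> is infinite, so its sum has the junk value \<open>0\<close>.\<close>

lemma divisor_power_sum_0 [simp]: "divisor_power_sum k 0 = 0"
  by (simp add: divisor_power_sum_def)

lemma lambert_sums:
  assumes "norm q < 1"
  shows "(\<lambda>n. of_nat (divisor_power_sum k n) * q ^ n) sums lambert k q"
proof -
  have "((\<lambda>n. of_nat (divisor_power_sum k n) * q ^ n) has_sum lambert k q) UNIV"
    using lambert_has_sum_divisors[OF assms]
    by (rule has_sum_cong_neutral[THEN iffD1, rotated -1]) (auto simp: not_le)
  then show ?thesis
    by (rule has_sum_imp_sums)
qed

lemma lambert_sums_Suc:
  assumes "norm q < 1"
  shows "(\<lambda>n. of_nat (divisor_power_sum k (Suc n)) * q ^ Suc n) sums lambert k q"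
  using lambert_sums[OF assms, of k] sums_Suc_iff[of "\<lambda>n. of_nat (divisor_power_sum k n) * q ^ n"]
  by simp

lemma E2_eq: "z \<in> upper_half_plane \<Longrightarrow> E2 z = 1 - 24 * lambert 1 (nome z)"
  unfolding E2_def using lambert_sums_Suc[of "nome z" 1] norm_nome_less_1[of z] by (simp add: sums_iff)

lemma E4_eq: "z \<in> upper_half_plane \<Longrightarrow> E4 z = 1 + 240 * lambert 3 (nome z)"
  unfolding E4_def using lambert_sums_Suc[of "nome z" 3] norm_nome_less_1[of z] by (simp add: sums_iff)

subsection \<open>\<open>q\<close>-expansions\<close>

text \<open>Carrying the formal series along reduces identities to coefficients; holomorphy,
  periodicity and the expansion at the cusp come with it.\<close>

definition q_expansion :: "(complex \<Rightarrow> complex) \<Rightarrow> complex fps \<Rightarrow> bool" where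
  "q_expansion f F \<longleftrightarrow> 1 \<le> fps_conv_radius F \<and> (\<forall>z\<in>upper_half_plane. f z = eval_fps F (nome z))"

lemma q_expansion_nome_in_radius:
  assumes "q_expansion f F" "z \<in> upper_half_plane"
  shows "ereal (norm (nome z)) < fps_conv_radius F"
  using assms norm_nome_less_1[of z] unfolding q_expansion_def
  by (meson ereal_less(3) less_le_trans)

lemma q_expansion_const: "q_expansion (\<lambda>z. c) (fps_const c)"
  by (simp add: q_expansion_def)

lemma q_expansion_add:
  assumes "q_expansion f F" "q_expansion g G"
  shows "q_expansion (\<lambda>z. f z + g z) (F + G)"
  using assms fps_conv_radius_add[of F G] q_expansion_nome_in_radius[OF assms(1)]
    q_expansion_nome_in_radius[OF assms(2)]
  by (auto simp: q_expansion_def eval_fps_add intro: order_trans[rotated])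

lemma q_expansion_diff:
  assumes "q_expansion f F" "q_expansion g G"
  shows "q_expansion (\<lambda>z. f z - g z) (F - G)"
  using assms fps_conv_radius_diff[of F G] q_expansion_nome_in_radius[OF assms(1)]
    q_expansion_nome_in_radius[OF assms(2)]
  by (auto simp: q_expansion_def eval_fps_diff intro: order_trans[rotated])

lemma q_expansion_mult:
  assumes "q_expansion f F" "q_expansion g G"
  shows "q_expansion (\<lambda>z. f z * g z) (F * G)"
  using assms fps_conv_radius_mult[of F G] q_expansion_nome_in_radius[OF assms(1)]
    q_expansion_nome_in_radius[OF assms(2)]
  by (auto simp: q_expansion_def eval_fps_mult intro: order_trans[rotated])

lemma q_expansion_has_field_derivative:
  assumes "q_expansion f F" "z \<in> upper_half_plane"
  shows "(f has_field_derivative 2 * of_real pi * \<i> * (nome z * eval_fps (fps_deriv F) (nome z))) (at z)"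
proof -
  have "((\<lambda>z. eval_fps F (nome z)) has_field_derivative
      eval_fps (fps_deriv F) (nome z) * (2 * of_real pi * \<i> * nome z * 1)) (at z)"
    using q_expansion_nome_in_radius[OF assms]
    by (intro DERIV_chain2[OF has_field_derivative_eval_fps] derivative_intros)
  then show ?thesis
  proof (rule DERIV_cong_ev[OF refl _ , THEN iffD2, rotated 2])
    show "\<forall>\<^sub>F w in nhds z. f w = eval_fps F (nome w)"
      using assms eventually_nhds_in_open[OF open_upper_half_plane assms(2)]
      by (auto simp: q_expansion_def elim!: eventually_mono)
  qed (simp add: mult_ac)
qed

text \<open>By the chain rule \<open>D_op\<close> acts as \<open>q d/dq\<close>, and differentiation
  does not shrink the disc of convergence.\<close>

lemma q_expansion_D_op:
  assumes "q_expansion f F"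
  shows "q_expansion (D_op f) (fps_X * fps_deriv F)"
  unfolding q_expansion_def
proof (intro conjI ballI)
  have *: "1 \<le> fps_conv_radius (fps_deriv F)"
    using assms fps_conv_radius_deriv[of F] by (auto simp: q_expansion_def intro: order_trans)
  then show "1 \<le> fps_conv_radius (fps_X * fps_deriv F)"
    using fps_conv_radius_mult[of fps_X "fps_deriv F"] by (auto intro: order_trans[rotated])
  fix z assume z: "z \<in> upper_half_plane"
  have "ereal (norm (nome z)) < fps_conv_radius (fps_deriv F)"
    using norm_nome_less_1[OF z] * by (meson ereal_less(3) less_le_trans)
  then show "D_op f z = eval_fps (fps_X * fps_deriv F) (nome z)"
    using DERIV_imp_deriv[OF q_expansion_has_field_derivative[OF assms z]]
    by (simp add: D_op_def eval_fps_mult)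
qed

lemma q_expansion_holomorphic:
  assumes "q_expansion f F"
  shows "f holomorphic_on upper_half_plane"
  using q_expansion_has_field_derivative[OF assms] holomorphic_on_open open_upper_half_plane by blast

lemma q_expansion_periodic:
  assumes "q_expansion f F" "z \<in> upper_half_plane"
  shows "f (z + 1) = f z"
  using assms by (auto simp: q_expansion_def nome_add_1 upper_half_plane_def)

text \<open>The constant term is 0 by \<open>divisor_power_sum_0\<close>, so this is the full
  expansion of \<open>lambert k\<close>.\<close>

definition sigma_fps :: "nat \<Rightarrow> complex fps" where
  "sigma_fps k = Abs_fps (\<lambda>n. of_nat (divisor_power_sum k n))"

lemma sigma_fps_conv_radius: "1 \<le> fps_conv_radius (sigma_fps k)"
  unfolding fps_conv_radius_def
proof (rule conv_radius_geI_ex')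
  fix r :: real assume "0 < r" "ereal r < 1"
  then show "summable (\<lambda>n. fps_nth (sigma_fps k) n * of_real r ^ n)"
    using lambert_sums[of "of_real r" k] by (simp add: sigma_fps_def sums_iff)
qed

lemma q_expansion_lambert: "q_expansion (\<lambda>z. lambert k (nome z)) (sigma_fps k)"
  using lambert_sums[OF norm_nome_less_1, of _ k] sigma_fps_conv_radius[of k]
  by (simp add: q_expansion_def eval_fps_def sigma_fps_def sums_iff)

lemma q_expansion_E2: "q_expansion E2 (1 - 24 * sigma_fps 1)"
  using q_expansion_diff[OF q_expansion_const q_expansion_mult[OF q_expansion_const q_expansion_lambert],
      of 1 24 1]
  by (simp add: q_expansion_def E2_eq numeral_fps_const)

lemma q_expansion_E4: "q_expansion E4 (1 + 240 * sigma_fps 3)"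
  using q_expansion_add[OF q_expansion_const q_expansion_mult[OF q_expansion_const q_expansion_lambert],
      of 1 240 3]
  by (simp add: q_expansion_def E4_eq numeral_fps_const)

text \<open>On the right, 576 = 48 * 12 times the square is rewritten by the convolution formula;
  the terms in \<open>s 3 n\<close> and the plain terms in \<open>s 1 n\<close> cancel, leaving
  \<open>- 288 n * s 1 n\<close> as on the left.\<close>

lemma ramanujan_fps:
  "12 * (fps_X * fps_deriv (1 - 24 * sigma_fps 1)) = (1 - 24 * sigma_fps 1)\<^sup>2 - (1 + 240 * sigma_fps 3)"
proof (rule fps_ext)
  fix n :: nat
  define s where "s k m = (of_nat (divisor_power_sum k m) :: complex)" for k m
  have conv: "12 * fps_nth ((sigma_fps 1)\<^sup>2) n = 5 * s 3 n + s 1 n - 6 * of_nat n * s 1 n"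
  proof (cases "n = 0")
    case False
    \<comment> \<open>The two end terms vanish by \<open>divisor_power_sum_0\<close>.\<close>
    have "(\<Sum>k=0..n. s 1 k * s 1 (n - k)) = (\<Sum>k\<in>{0<..<n}. s 1 k * s 1 (n - k))"
      by (rule sum.mono_neutral_right) (auto simp: s_def not_less)
    then have "fps_nth ((sigma_fps 1)\<^sup>2) n = (\<Sum>k\<in>{0<..<n}. s 1 k * s 1 (n - k))"
      by (simp add: power2_eq_square fps_mult_nth sigma_fps_def s_def)
    moreover have "of_int (12 * (\<Sum>k\<in>{0<..<n}. int (divisor_power_sum 1 k * divisor_power_sum 1 (n - k)))) =
        (of_int (5 * int (divisor_power_sum 3 n) + int (divisor_power_sum 1 n)
          - 6 * int n * int (divisor_power_sum 1 n)) :: complex)"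
      using False by (subst divisor_sum_convolution) auto
    ultimately show ?thesis
      by (simp add: s_def)
  qed (simp add: s_def sigma_fps_def power2_eq_square fps_mult_nth)
  have lhs: "fps_nth (12 * (fps_X * fps_deriv (1 - 24 * sigma_fps 1))) n = - (288 * of_nat n * s 1 n)"
    by (cases n) (simp_all add: numeral_fps_const sigma_fps_def s_def algebra_simps)
  have rhs: "(1 - 24 * sigma_fps 1)\<^sup>2 - (1 + 240 * sigma_fps 3) =
      fps_const 576 * (sigma_fps 1)\<^sup>2 - fps_const 48 * sigma_fps 1 - fps_const 240 * sigma_fps 3"
    by (simp add: power2_eq_square algebra_simps flip: numeral_fps_const)
  have nth: "fps_nth (fps_const 576 * (sigma_fps 1)\<^sup>2 - fps_const 48 * sigma_fps 1
      - fps_const 240 * sigma_fps 3) n = 48 * (12 * fps_nth ((sigma_fps 1)\<^sup>2) n) - 48 * s 1 n - 240 * s 3 n"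
    by (simp add: sigma_fps_def s_def)
  show "fps_nth (12 * (fps_X * fps_deriv (1 - 24 * sigma_fps 1))) n =
      fps_nth ((1 - 24 * sigma_fps 1)\<^sup>2 - (1 + 240 * sigma_fps 3)) n"
    unfolding lhs rhs nth conv by (simp add: algebra_simps)
qed

theorem ramanujan_E2:
  assumes z: "z \<in> upper_half_plane"
  shows "12 * D_op E2 z = (E2 z)\<^sup>2 - E4 z"
proof -
  have "q_expansion (\<lambda>z. 12 * D_op E2 z) (12 * (fps_X * fps_deriv (1 - 24 * sigma_fps 1)))"
    using q_expansion_mult[OF q_expansion_const q_expansion_D_op[OF q_expansion_E2], of 12]
    by (simp add: numeral_fps_const)
  moreover have "q_expansion (\<lambda>z. (E2 z)\<^sup>2 - E4 z) ((1 - 24 * sigma_fps 1)\<^sup>2 - (1 + 240 * sigma_fps 3))"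
    unfolding power2_eq_square
    by (intro q_expansion_diff q_expansion_mult q_expansion_E2 q_expansion_E4)
  ultimately show ?thesis
    using z by (metis q_expansion_def ramanujan_fps)
qed

subsection \<open>Sums over the integers\<close>

lemma has_sum_int_split:
  fixes f :: "int \<Rightarrow> 'a :: {t2_space, topological_comm_monoid_add}"
  assumes "((\<lambda>n. f (int n)) has_sum A) UNIV" "((\<lambda>n. f (- int (Suc n))) has_sum B) UNIV"
  shows "(f has_sum (A + B)) UNIV"
proof -
  have "bij_betw int UNIV {0..}"
    by (rule bij_betwI[where g = nat]) auto
  then have "(f has_sum A) {0..}"
    using has_sum_reindex_bij_betw assms(1) by metis
  moreover have "bij_betw (\<lambda>n. - int (Suc n)) UNIV {..<0}"
    by (rule bij_betwI[where g = "\<lambda>d. nat (- d - 1)"]) auto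
  then have "(f has_sum B) {..<0}"
    using has_sum_reindex_bij_betw[of "\<lambda>n. - int (Suc n)" UNIV "{..<0}" f B] assms(2) by simp
  ultimately have "(f has_sum (A + B)) ({0..} \<union> {..<0})"
    by (rule has_sum_Un_disjoint) auto
  moreover have "{0..} \<union> {..<0} = (UNIV :: int set)" by auto
  ultimately show ?thesis by simp
qed

lemma has_sum_nonzero_int_even:
  fixes f :: "int \<Rightarrow> 'a :: {t2_space, topological_comm_monoid_add}"
  assumes "\<And>c. f (- c) = f c" "((\<lambda>n. f (int n)) has_sum A) {1..}"
  shows "(f has_sum (A + A)) {c. c \<noteq> 0}"
proof -
  have "bij_betw int {1..} {0<..}"
    by (rule bij_betwI[where g = nat]) auto
  then have pos: "(f has_sum A) {0<..}"
    using has_sum_reindex_bij_betw assms(2) by metis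
  moreover have "bij_betw uminus {0<..} {..<0 :: int}"
    by (rule bij_betwI[where g = uminus]) auto
  then have "(f has_sum A) {..<0}"
    using has_sum_reindex_bij_betw[of uminus "{0<..}" "{..<0}" f A] pos assms(1) by simp
  ultimately have "(f has_sum (A + A)) ({0<..} \<union> {..<0})"
    by (rule has_sum_Un_disjoint) auto
  moreover have "{0<..} \<union> {..<0} = {c :: int. c \<noteq> 0}" by auto
  ultimately show ?thesis by simp
qed

lemma has_sum_nat_of_sums:
  fixes f :: "nat \<Rightarrow> 'a :: banach"
  assumes "f sums S" "(\<lambda>x. norm (f x)) summable_on UNIV"
  shows "(f has_sum S) UNIV"
  using norm_summable_imp_has_sum[OF _ assms(1)] summable_on_imp_summable[OF assms(2)] by simp

lemma abs_summable_on_int_slice: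
  fixes f :: "int \<Rightarrow> 'a :: banach"
  assumes "(\<lambda>x. norm (f x)) summable_on UNIV"
  shows "(\<lambda>n. norm (f (int n))) summable_on UNIV" "(\<lambda>n. norm (f (- int (Suc n)))) summable_on UNIV"
proof -
  have inj: "inj int" "inj (\<lambda>n. - int (Suc n))" by (auto intro: injI)
  have "(\<lambda>x. norm (f x)) summable_on range int" "(\<lambda>x. norm (f x)) summable_on range (\<lambda>n. - int (Suc n))"
    using assms by (auto intro: summable_on_subset)
  then show "(\<lambda>n. norm (f (int n))) summable_on UNIV" "(\<lambda>n. norm (f (- int (Suc n)))) summable_on UNIV"
    using summable_on_reindex[OF inj(1), of "\<lambda>x. norm (f x)"]
      summable_on_reindex[OF inj(2), of "\<lambda>x. norm (f x)"] by (simp_all add: o_def)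
qed

lemma has_sum_int_of_sums:
  fixes f :: "int \<Rightarrow> 'a :: banach"
  assumes "(\<lambda>n. f (int n)) sums A" "(\<lambda>n. f (- int (Suc n))) sums B" "(\<lambda>x. norm (f x)) summable_on UNIV"
  shows "(f has_sum (A + B)) UNIV"
  using assms abs_summable_on_int_slice[OF assms(3)]
  by (intro has_sum_int_split has_sum_nat_of_sums)

text \<open>The two half-lines contribute \<open>b 0\<close> and \<open>- b 0\<close>; absolute
  summability turns these ordered sums into unordered ones.\<close>

lemma has_sum_telescope_int:
  fixes b :: "int \<Rightarrow> 'a :: banach"
  assumes "(\<lambda>n. b (int n)) \<longlonglongrightarrow> 0" "(\<lambda>n. b (- int n)) \<longlonglongrightarrow> 0"
    and "(\<lambda>d. norm (b d - b (d + 1))) summable_on UNIV"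
  shows "((\<lambda>d. b d - b (d + 1)) has_sum 0) UNIV"
proof -
  have "(\<lambda>n. b (int n) - b (int (Suc n))) sums (b (int 0) - 0)"
    by (rule telescope_sums'[OF assms(1)])
  moreover have "(\<lambda>n. b (- int (Suc n)) - b (- int n)) sums (0 - b (- int 0))"
    by (rule telescope_sums[OF assms(2)])
  ultimately have "((\<lambda>d. b d - b (d + 1)) has_sum ((b (int 0) - 0) + (0 - b (- int 0)))) UNIV"
    using assms(3) by (intro has_sum_int_of_sums) (simp_all add: add_ac)
  then show ?thesis by simp
qed

text \<open>The intervals from \<open>-N\<close> to \<open>N\<close> eventually contain every finite
  set. Only along such intervals are the columns of the telescoping terms evaluated later.\<close>

lemma has_sum_int_imp_symmetric_limit:
  fixes f :: "int \<Rightarrow> 'a :: {comm_monoid_add, topological_space}"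
  assumes "(f has_sum S) UNIV"
  shows "(\<lambda>N. \<Sum>d\<in>{- int N..int N}. f d) \<longlonglongrightarrow> S"
proof -
  have "filterlim (\<lambda>N. {- int N..int N}) (finite_subsets_at_top UNIV) sequentially"
    unfolding filterlim_def le_filter_def eventually_filtermap eventually_finite_subsets_at_top
  proof safe
    fix P and X :: "int set" assume X: "finite X" "\<forall>Y. finite Y \<and> X \<subseteq> Y \<and> Y \<subseteq> UNIV \<longrightarrow> P Y"
    obtain N0 where N0: "\<forall>n\<in>(\<lambda>d. nat \<bar>d\<bar>) ` X. n \<le> N0"
      using X(1) finite_nat_set_iff_bounded_le by blast
    show "\<forall>\<^sub>F N in sequentially. P {- int N..int N}"
      using eventually_ge_at_top[of N0]
    proof eventually_elim
      case (elim N)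
      then have "X \<subseteq> {- int N..int N}" using N0 by fastforce
      then show ?case using X(2) by auto
    qed
  qed
  then show ?thesis
    using assms unfolding has_sum_def by (rule filterlim_compose[rotated])
qed

lemma summable_on_int_inverse_square: "(\<lambda>d :: int. 1 / (1 + (real_of_int d)\<^sup>2)) summable_on UNIV"
proof -
  have base: "(\<lambda>n. 2 * (1 / (real n + 1)\<^sup>2)) summable_on UNIV"
    using sums_mult[OF inverse_squares_sums, of 2]
    by (intro summable_nonneg_imp_summable_on) (auto simp: sums_iff add_ac)
  have bound: "1 / (1 + (real n)\<^sup>2) \<le> 2 * (1 / (real n + 1)\<^sup>2)"
    "1 / (1 + (real_of_int (- int (Suc n)))\<^sup>2) \<le> 2 * (1 / (real n + 1)\<^sup>2)" for n
  proof -
    have "(real n + 1)\<^sup>2 \<le> 2 * (1 + (real n)\<^sup>2)"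
      using zero_le_power2[of "real n - 1"] by (simp add: power2_eq_square algebra_simps)
    then show "1 / (1 + (real n)\<^sup>2) \<le> 2 * (1 / (real n + 1)\<^sup>2)"
      by (simp add: field_simps add_pos_nonneg)
    have "1 / (1 + (real n + 1)\<^sup>2) \<le> 1 / (real n + 1)\<^sup>2"
      by (rule divide_left_mono) (auto intro!: mult_pos_pos add_pos_nonneg)
    also have "\<dots> \<le> 2 * (1 / (real n + 1)\<^sup>2)" by (simp add: divide_right_mono)
    finally show "1 / (1 + (real_of_int (- int (Suc n)))\<^sup>2) \<le> 2 * (1 / (real n + 1)\<^sup>2)"
      by (simp add: power2_eq_square algebra_simps)
  qed
  have "(\<lambda>n. 1 / (1 + (real_of_int (int n))\<^sup>2)) summable_on UNIV"
    by (rule summable_on_comparison_test[OF base]) (use bound(1) in simp_all)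
  moreover have "(\<lambda>n. 1 / (1 + (real_of_int (- int (Suc n)))\<^sup>2)) summable_on UNIV"
    by (rule summable_on_comparison_test[OF base]) (use bound(2) in simp_all)
  ultimately show ?thesis
    using has_sum_int_split[of "\<lambda>d. 1 / (1 + (real_of_int d)\<^sup>2)"]
    by (meson has_sum_imp_summable has_sum_infsum)
qed

subsection \<open>Partial fractions\<close>

lemma sin_pi_mult_nonzero:
  fixes z :: complex
  assumes "z \<notin> \<int>"
  shows "sin (of_real pi * z) \<noteq> 0"
proof
  assume "sin (of_real pi * z) = 0"
  then obtain n :: int where "of_real pi * z = of_real (of_int n * pi)"
    by (auto simp: sin_eq_0)
  then have "z = of_int n" by simp
  with assms show False by auto
qed

text \<open>The product \<open>Gamma z * Gamma (1 - z) * sin (pi z)\<close> is constantly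
  \<open>pi\<close> off the integers, so its derivative vanishes; dividing by the nonzero Gamma
  factors leaves the formula.\<close>

lemma Digamma_reflection:
  fixes z :: complex
  assumes z: "z \<notin> \<int>"
  shows "Digamma (1 - z) - Digamma z = of_real pi * cot (of_real pi * z)"
proof -
  have nz: "sin (of_real pi * z) \<noteq> 0" if "z \<notin> \<int>" for z :: complex
    using that by (rule sin_pi_mult_nonzero)
  have z1: "1 - z \<notin> \<int>" using z by (metis Ints_1 Ints_diff diff_diff_eq2 add_diff_cancel_left' diff_add_cancel)
  have z0: "z \<notin> \<int>\<^sub>\<le>\<^sub>0" "1 - z \<notin> \<int>\<^sub>\<le>\<^sub>0" using z z1 nonpos_Ints_Int by blast+
  have G0: "Gamma z \<noteq> 0" "Gamma (1 - z) \<noteq> 0" using z0 by (auto simp: Gamma_eq_zero_iff)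
  have "((\<lambda>z. Gamma z * Gamma (1 - z) * sin (of_real pi * z)) has_field_derivative
      (Gamma z * Gamma (1 - z) * (Digamma z - Digamma (1 - z)) * sin (of_real pi * z) +
       Gamma z * Gamma (1 - z) * (of_real pi * cos (of_real pi * z)))) (at z)"
    using z0 by (auto intro!: derivative_eq_intros simp: algebra_simps)
  moreover have "Gamma z * Gamma (1 - z) * sin (of_real pi * z) = of_real pi" if "z \<notin> \<int>" for z :: complex
    using Gamma_reflection_complex[of z] nz[OF that] by simp
  moreover have "open (- \<int> :: complex set)"
    using closed_Ints by (simp add: open_closed)
  ultimately have "((\<lambda>z. of_real pi) has_field_derivative
      (Gamma z * Gamma (1 - z) * (Digamma z - Digamma (1 - z)) * sin (of_real pi * z) +
       Gamma z * Gamma (1 - z) * (of_real pi * cos (of_real pi * z)))) (at z)"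
    using z by (elim has_field_derivative_transform_within_open) auto
  then have "Gamma z * Gamma (1 - z) * (Digamma z - Digamma (1 - z)) * sin (of_real pi * z) +
       Gamma z * Gamma (1 - z) * (of_real pi * cos (of_real pi * z)) = 0"
    using DERIV_const DERIV_unique by blast
  then have "Gamma z * Gamma (1 - z) * ((Digamma z - Digamma (1 - z)) * sin (of_real pi * z) +
      of_real pi * cos (of_real pi * z)) = 0"
    by (simp add: algebra_simps)
  then have "(Digamma z - Digamma (1 - z)) * sin (of_real pi * z) + of_real pi * cos (of_real pi * z) = 0"
    using G0 by simp
  then have "(Digamma (1 - z) - Digamma z) * sin (of_real pi * z) = of_real pi * cos (of_real pi * z)"
    by (simp add: algebra_simps)
  then show ?thesis using nz[OF z] by (simp add: cot_def field_simps)
qed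

text \<open>The derivative of \<open>Digamma_reflection\<close>. The two terms on the left are the
  halves \<open>d >= 0\<close> and \<open>d < 0\<close> of the sum of
  \<open>1 / (z + d)^2\<close>.\<close>

lemma Polygamma_1_reflection:
  fixes z :: complex
  assumes z: "z \<notin> \<int>"
  shows "Polygamma 1 z + Polygamma 1 (1 - z) = of_real pi ^ 2 / sin (of_real pi * z) ^ 2"
proof -
  have z1: "1 - z \<notin> \<int>" using z by (metis Ints_1 Ints_diff diff_diff_eq2 add_diff_cancel_left' diff_add_cancel)
  have z0: "z \<notin> \<int>\<^sub>\<le>\<^sub>0" "1 - z \<notin> \<int>\<^sub>\<le>\<^sub>0" using z z1 nonpos_Ints_Int by blast+
  note nz = sin_pi_mult_nonzero[OF z]
  have "((\<lambda>z. Digamma (1 - z) - Digamma z) has_field_derivative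
      (- Polygamma 1 (1 - z) - Polygamma 1 z)) (at z)"
    using z0 by (auto intro!: derivative_eq_intros)
  moreover have "open (- \<int> :: complex set)"
    using closed_Ints by (simp add: open_closed)
  ultimately have "((\<lambda>z. of_real pi * (cos (of_real pi * z) / sin (of_real pi * z))) has_field_derivative
      (- Polygamma 1 (1 - z) - Polygamma 1 z)) (at z)"
    using z by (elim has_field_derivative_transform_within_open) (auto simp: Digamma_reflection cot_def)
  moreover have "((\<lambda>z. of_real pi * (cos (of_real pi * z) / sin (of_real pi * z))) has_field_derivative
      - (of_real pi ^ 2 / sin (of_real pi * z) ^ 2)) (at z)"
  proof -
    have "((\<lambda>z. of_real pi * (cos (of_real pi * z) / sin (of_real pi * z))) has_field_derivative
      of_real pi * ((- sin (of_real pi * z) * of_real pi * sin (of_real pi * z) -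
        cos (of_real pi * z) * (cos (of_real pi * z) * of_real pi)) /
        (sin (of_real pi * z) * sin (of_real pi * z)))) (at z)"
      using nz by (auto intro!: derivative_eq_intros simp: algebra_simps)
    also have "(- sin (of_real pi * z) * of_real pi * sin (of_real pi * z) -
        cos (of_real pi * z) * (cos (of_real pi * z) * of_real pi)) =
        - of_real pi * ((sin (of_real pi * z))\<^sup>2 + (cos (of_real pi * z))\<^sup>2)"
      by algebra
    also have "\<dots> = - of_real pi"
      by simp
    finally show ?thesis unfolding power2_eq_square by simp
  qed
  ultimately have "- Polygamma 1 (1 - z) - Polygamma 1 z = - (of_real pi ^ 2 / sin (of_real pi * z) ^ 2)"
    by (rule DERIV_unique)
  then show ?thesis by (simp add: algebra_simps)
qed

text \<open>Subtracting the series of \<open>Digamma (1 + t)\<close> and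
  \<open>Digamma (1 - t)\<close> term by term removes the divergent parts; shift and reflection then
  produce the cotangent.\<close>

lemma cot_partial_fractions:
  fixes t :: complex
  assumes t: "t \<notin> \<int>"
  shows "(\<lambda>n. 1 / (of_nat (Suc n) - t) - 1 / (of_nat (Suc n) + t)) sums
    (1 / t - of_real pi * cot (of_real pi * t))"
proof -
  have nz: "1 - t \<noteq> 0" "1 + t \<noteq> 0" "t \<noteq> 0"
    using t Ints_minus[of "- t"] by (auto simp: add_eq_0_iff)
  have D: "(\<lambda>n. inverse (of_nat (Suc n)) - inverse (z + of_nat n)) sums (Digamma z + euler_mascheroni)"
    if "z \<noteq> 0" for z :: complex
    using summable_Digamma[OF that] by (simp add: Digamma_def summable_sums)
  have "(\<lambda>n. 1 / (of_nat (Suc n) - t) - 1 / (of_nat (Suc n) + t)) sums (Digamma (1 + t) - Digamma (1 - t))"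
    using sums_diff[OF D[OF nz(2)] D[OF nz(1)]] by (simp add: divide_inverse algebra_simps)
  moreover have "Digamma (1 + t) = Digamma t + 1 / t"
    using Digamma_plus1[OF nz(3)] by (simp add: add.commute)
  ultimately show ?thesis
    using Digamma_reflection[OF t] by (simp add: algebra_simps)
qed

subsection \<open>Lattice sums and the inversion of \<open>E\<^sub>2\<close>\<close>

text \<open>The squared norm is a positive definite quadratic form in \<open>x\<close> and
  \<open>y\<close>. Real arguments permit the later shifts by 1/2.\<close>

lemma lattice_norm_bound:
  assumes "Im z \<noteq> 0"
  obtains M where "0 < M"
    and "\<And>x y :: real. x\<^sup>2 + y\<^sup>2 \<le> M * (norm (of_real x * z + of_real y))\<^sup>2"
proof
  \<comment> \<open>The 2 pays for \<open>y^2 <= 2 (x Re z + y)^2 + 2 (x Re z)^2\<close>; the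
    fraction turns \<open>(x Im z)^2\<close> into the remaining
    \<open>x^2 + 2 (x Re z)^2\<close>.\<close>
  define M where "M = 2 + (1 + 2 * (Re z)\<^sup>2) / (Im z)\<^sup>2"
  show "0 < M" by (auto simp: M_def add_pos_nonneg)
  fix x y :: real
  have "y\<^sup>2 \<le> 2 * (x * Re z + y)\<^sup>2 + 2 * (x * Re z)\<^sup>2"
    using zero_le_power2[of "2 * (x * Re z) + y"] by (simp add: power2_eq_square algebra_simps)
  moreover have "(1 + 2 * (Re z)\<^sup>2) / (Im z)\<^sup>2 * (x * Im z)\<^sup>2 = x\<^sup>2 + 2 * (x * Re z)\<^sup>2"
    using assms by (simp add: power_mult_distrib field_simps)
  ultimately have "x\<^sup>2 + y\<^sup>2 \<le> 2 * (x * Re z + y)\<^sup>2 + (1 + 2 * (Re z)\<^sup>2) / (Im z)\<^sup>2 * (x * Im z)\<^sup>2"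
    by linarith
  also have "\<dots> \<le> M * (x * Re z + y)\<^sup>2 + M * (x * Im z)\<^sup>2"
    unfolding M_def by (intro add_mono mult_right_mono) (auto intro!: divide_nonneg_nonneg add_nonneg_nonneg)
  also have "\<dots> = M * (norm (of_real x * z + of_real y))\<^sup>2"
    by (simp add: cmod_power2 algebra_simps)
  finally show "x\<^sup>2 + y\<^sup>2 \<le> M * (norm (of_real x * z + of_real y))\<^sup>2" .
qed

lemma has_sum_inverse_squares_int:
  assumes "Im t \<noteq> 0"
  shows "((\<lambda>d :: int. 1 / (t + of_int d)\<^sup>2) has_sum (of_real pi ^ 2 / sin (of_real pi * t) ^ 2)) UNIV"
proof -
  obtain M where M: "0 < M" "\<And>x y :: real. x\<^sup>2 + y\<^sup>2 \<le> M * (norm (of_real x * t + of_real y))\<^sup>2"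
    using lattice_norm_bound[OF assms] by blast
  have t: "t \<notin> \<int>" using assms by (auto elim: Ints_cases)
  have P: "(\<lambda>k. 1 / (z + of_nat k)\<^sup>2) sums Polygamma 1 z" if "z \<noteq> 0" for z :: complex
    using Polygamma_LIMSEQ[OF that, of 1] by (simp add: power2_eq_square divide_inverse)
  have "(\<lambda>d :: int. norm (1 / (t + of_int d)\<^sup>2)) summable_on UNIV"
  proof (rule Infinite_Sum.abs_summable_on_comparison_test'[where g = "\<lambda>d. M * (1 / (1 + (real_of_int d)\<^sup>2))"])
    show "(\<lambda>d :: int. M * (1 / (1 + (real_of_int d)\<^sup>2))) summable_on UNIV"
      by (intro summable_on_cmult_right summable_on_int_inverse_square)
    fix d :: int
    have "t + of_int d \<noteq> 0" using assms by (auto simp: complex_eq_iff)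
    moreover have "1 + (real_of_int d)\<^sup>2 \<le> M * (norm (t + of_int d))\<^sup>2"
      using M(2)[of 1 "real_of_int d"] by simp
    ultimately show "norm (1 / (t + of_int d)\<^sup>2) \<le> M * (1 / (1 + (real_of_int d)\<^sup>2))"
      by (simp add: norm_divide norm_power field_simps add_pos_nonneg)
  qed
  moreover have "(\<lambda>n. 1 / (t + of_int (int n))\<^sup>2) sums Polygamma 1 t"
    using P[of t] t by (cases "t = 0") auto
  moreover have "(\<lambda>n. 1 / (t + of_int (- int (Suc n)))\<^sup>2) sums Polygamma 1 (1 - t)"
  proof -
    have "(t + of_int (- int (Suc n)))\<^sup>2 = (1 - t + of_nat n)\<^sup>2" for n
      by (simp add: power2_eq_square algebra_simps)
    then show ?thesis using P[of "1 - t"] t by (cases "t = 1") auto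
  qed
  ultimately have "((\<lambda>d :: int. 1 / (t + of_int d)\<^sup>2) has_sum (Polygamma 1 t + Polygamma 1 (1 - t))) UNIV"
    by (intro has_sum_int_of_sums)
  then show ?thesis unfolding Polygamma_1_reflection[OF t] .
qed

text \<open>With \<open>e = exp (pi i t)\<close> the sine is \<open>(e - 1/e) / (2 i)\<close> and
  the nome is \<open>e^2\<close>. At integers both sides are 0 by the convention for division by
  0.\<close>

lemma pi_squared_over_sin_squared:
  "of_real pi ^ 2 / sin (of_real pi * t) ^ 2 = - 4 * of_real pi ^ 2 * (nome t / (1 - nome t)\<^sup>2)"
proof -
  define e where "e = exp (\<i> * (of_real pi * t))"
  have e: "e \<noteq> 0" "nome t = e\<^sup>2" "exp (- (\<i> * (of_real pi * t))) = 1 / e"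
    by (simp_all add: e_def nome_def exp_minus divide_inverse mult_ac flip: exp_double)
  have "sin (of_real pi * t) = (e - 1 / e) / (2 * \<i>)"
    unfolding sin_exp_eq e(3) by (simp add: e_def)
  moreover have "((e - 1 / e) / (2 * \<i>))\<^sup>2 = - ((1 - nome t)\<^sup>2 / (4 * nome t))"
    using e(1) unfolding e(2) by (simp add: power2_eq_square field_simps)
  ultimately have "sin (of_real pi * t) ^ 2 = - ((1 - nome t)\<^sup>2 / (4 * nome t))"
    by simp
  then show ?thesis by simp
qed

text \<open>Written in \<open>nome (- t)\<close> because the argument will be
  \<open>(N + 1/2) / z\<close>, whose negative lies in the upper half-plane.\<close>

lemma cot_eq_nome:
  "cot (of_real pi * t) = \<i> * (1 + nome (- t)) / (1 - nome (- t))"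
proof -
  define e where "e = exp (- (\<i> * (of_real pi * t)))"
  have e: "e \<noteq> 0" "nome (- t) = e\<^sup>2" "exp (\<i> * (of_real pi * t)) = 1 / e"
    by (simp_all add: e_def nome_def mult_ac flip: exp_double) (simp add: exp_minus divide_inverse)
  have "sin (of_real pi * t) = (1 / e - e) / (2 * \<i>)" "cos (of_real pi * t) = (1 / e + e) / 2"
    unfolding sin_exp_eq cos_exp_eq e(3) by (simp_all add: e_def)
  then have "cot (of_real pi * t) = ((1 / e + e) / 2) / ((1 / e - e) / (2 * \<i>))"
    by (simp only: cot_def)
  also have "\<dots> = \<i> * (1 / e + e) / (1 / e - e)"
  proof -
    have "(A / 2) / (B / (2 * \<i>)) = \<i> * A / B" for A B :: complex
      by (cases "B = 0") (auto simp: field_simps)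
    then show ?thesis .
  qed
  also have "\<dots> = \<i> * ((1 / e + e) * e) / ((1 / e - e) * e)"
    using e(1) by simp
  also have "\<dots> = \<i> * (1 + nome (- t)) / (1 - nome (- t))"
    using e by (simp add: power2_eq_square ring_distribs)
  finally show ?thesis .
qed

lemma upper_half_plane_minus_inverse:
  assumes "z \<in> upper_half_plane"
  shows "- 1 / z \<in> upper_half_plane" "z \<noteq> 0"
proof -
  show "z \<noteq> 0" using assms by (auto simp: upper_half_plane_def)
  then have "0 < (Re z)\<^sup>2 + (Im z)\<^sup>2"
    by (simp add: complex_neq_0)
  then show "- 1 / z \<in> upper_half_plane"
    using assms by (simp add: upper_half_plane_def Im_divide)
qed

text \<open>The summand is the sum of \<open>1 / (c t + d)\<^sup>2\<close> over \<open>d\<close>, so this is Eisenstein's sum over the rows.\<close>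

lemma has_sum_rows_E2:
  assumes t: "t \<in> upper_half_plane"
  shows "((\<lambda>c :: int. of_real pi ^ 2 / sin (of_real pi * (of_int c * t)) ^ 2) has_sum
    (of_real pi ^ 2 / 3 * (E2 t - 1))) {c. c \<noteq> 0}"
proof -
  let ?f = "\<lambda>c :: int. of_real pi ^ 2 / sin (of_real pi * (of_int c * t)) ^ 2"
  have "((\<lambda>c. - 4 * of_real pi ^ 2 * (nome t ^ c / (1 - nome t ^ c)\<^sup>2)) has_sum
      - 4 * of_real pi ^ 2 * lambert 1 (nome t)) {1..}"
    by (intro has_sum_cmult_right lambert_has_sum_columns norm_nome_less_1 t)
  then have "((\<lambda>n. ?f (int n)) has_sum (- 4 * of_real pi ^ 2 * lambert 1 (nome t))) {1..}"
    by (simp add: pi_squared_over_sin_squared nome_mult_of_nat)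
  then have "(?f has_sum (- 4 * of_real pi ^ 2 * lambert 1 (nome t) + - 4 * of_real pi ^ 2 * lambert 1 (nome t)))
      {c. c \<noteq> 0}"
    by (intro has_sum_nonzero_int_even) auto
  then show ?thesis
    using t by (simp add: E2_eq algebra_simps)
qed

lemma has_sum_inverse_squares_nonzero_int:
  "((\<lambda>d :: int. 1 / (of_int d)\<^sup>2 :: complex) has_sum (of_real pi ^ 2 / 3)) {d. d \<noteq> 0}"
proof -
  have s: "(\<lambda>n. 1 / (real (Suc n))\<^sup>2) sums (pi\<^sup>2 / 6)"
    using inverse_squares_sums by (simp add: add_ac)
  have "((\<lambda>n. 1 / (real (Suc n))\<^sup>2) has_sum (pi\<^sup>2 / 6)) UNIV"
    using s by (rule sums_nonneg_imp_has_sum) auto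
  then have "((\<lambda>n. of_real (1 / (real (Suc n))\<^sup>2) :: complex) has_sum of_real (pi\<^sup>2 / 6)) UNIV"
    by (rule has_sum_of_real)
  then have "((\<lambda>n. 1 / (of_int (int (Suc n)))\<^sup>2 :: complex) has_sum of_real (pi\<^sup>2 / 6)) UNIV"
    by simp
  moreover have "bij_betw Suc UNIV {1..}"
    by (rule bij_betwI[where g = "\<lambda>n. n - 1"]) auto
  ultimately have "((\<lambda>n. 1 / (of_int (int n))\<^sup>2 :: complex) has_sum of_real (pi\<^sup>2 / 6)) {1..}"
    using has_sum_reindex_bij_betw[of Suc UNIV "{1..}" "\<lambda>n. 1 / (of_int (int n))\<^sup>2 :: complex"] by blast
  then have "((\<lambda>d :: int. 1 / (of_int d)\<^sup>2 :: complex) has_sum (of_real (pi\<^sup>2 / 6) + of_real (pi\<^sup>2 / 6))) {d. d \<noteq> 0}"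
    by (intro has_sum_nonzero_int_even) auto
  then show ?thesis by simp
qed

section \<open>Estimates for the lattice terms and the telescoping comparison terms\<close>

lemma lattice_not_half_integer:
  assumes "Im z \<noteq> 0" "c \<noteq> 0"
  shows "of_int c * z + of_int d \<noteq> 0" "of_int c * z + of_int d - 1 / 2 \<noteq> 0"
    "of_int c * z + of_int d + 1 / 2 \<noteq> 0" "(of_int c * z + of_int d)\<^sup>2 - 1 / 4 \<noteq> 0"
proof -
  show *: "of_int c * z + of_int d \<noteq> 0" "of_int c * z + of_int d - 1 / 2 \<noteq> 0"
    "of_int c * z + of_int d + 1 / 2 \<noteq> 0"
    using assms by (auto simp: complex_eq_iff)
  have "(of_int c * z + of_int d)\<^sup>2 - 1 / 4 =
      (of_int c * z + of_int d - 1 / 2) * (of_int c * z + of_int d + 1 / 2)"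
    by (simp add: power2_eq_square algebra_simps)
  then show "(of_int c * z + of_int d)\<^sup>2 - 1 / 4 \<noteq> 0" using * by simp
qed

lemma telescoping_term:
  assumes "Im z \<noteq> 0" "c \<noteq> 0"
  shows "1 / ((of_int c * z + of_int d)\<^sup>2 - 1 / 4) =
    1 / (of_int c * z + of_int d - 1 / 2) - 1 / (of_int c * z + of_int d + 1 / 2)"
proof -
  note nz = lattice_not_half_integer[OF assms, of d]
  have "(of_int c * z + of_int d)\<^sup>2 - 1 / 4 =
      (of_int c * z + of_int d - 1 / 2) * (of_int c * z + of_int d + 1 / 2)"
    by (simp add: power2_eq_square algebra_simps)
  moreover have "1 / a - 1 / b = (b - a) / (a * b)" if "a \<noteq> 0" "b \<noteq> 0" for a b :: complex
    using that by (simp add: field_simps)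
  ultimately show ?thesis using nz by simp
qed

text \<open>For the second bound \<open>w^2 - 1/4\<close> is factored as
  \<open>(w - 1/2) (w + 1/2)\<close> and \<open>lattice_norm_bound\<close> is applied to each
  factor.\<close>

lemma lattice_term_bounds:
  assumes "Im z \<noteq> 0"
  obtains K where "0 < K"
    and "\<And>c d :: int. c \<noteq> 0 \<Longrightarrow>
      norm (1 / (of_int c * z + of_int d)\<^sup>2) \<le> K / ((real_of_int c)\<^sup>2 + (real_of_int d)\<^sup>2)"
    and "\<And>c d :: int. c \<noteq> 0 \<Longrightarrow>
      norm (1 / ((of_int c * z + of_int d)\<^sup>2 - 1 / 4)) \<le> K / ((real_of_int c)\<^sup>2 + (real_of_int d)\<^sup>2)"
proof -
  obtain M where M: "0 < M" "\<And>x y :: real. x\<^sup>2 + y\<^sup>2 \<le> M * (norm (of_real x * z + of_real y))\<^sup>2"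
    using lattice_norm_bound[OF assms] by blast
  show ?thesis
  proof
    show "0 < 4 * M" using M by simp
    fix c d :: int assume c: "c \<noteq> 0"
    define w where "w = of_int c * z + of_int d"
    define s where "s = (real_of_int c)\<^sup>2 + (real_of_int d)\<^sup>2"
    have s: "0 < s" using c by (simp add: s_def add_pos_nonneg)
    note nz = lattice_not_half_integer[OF assms c, of d, folded w_def]
    have w: "s \<le> M * (norm w)\<^sup>2"
      using M(2)[of "real_of_int c" "real_of_int d"] by (simp add: s_def w_def)
    then have "s \<le> 4 * M * (norm w)\<^sup>2" using s by linarith
    then show "norm (1 / (of_int c * z + of_int d)\<^sup>2) \<le> 4 * M / ((real_of_int c)\<^sup>2 + (real_of_int d)\<^sup>2)"
      unfolding w_def[symmetric] s_def[symmetric] using s nz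
      by (simp add: norm_divide norm_power field_simps)
    \<comment> \<open>The differences of the two sides are \<open>(d - 1) (3 d - 1)\<close> and
      \<open>(d + 1) (3 d + 1)\<close>. Integrality matters: the first is negative for real
      \<open>d\<close> between 1/3 and 1.\<close>
    have d1: "(real_of_int d)\<^sup>2 \<le> 4 * (real_of_int d - 1 / 2)\<^sup>2" "(real_of_int d)\<^sup>2 \<le> 4 * (real_of_int d + 1 / 2)\<^sup>2"
    proof -
      have "0 \<le> (d - 1) * (3 * d - 1)" "0 \<le> (d + 1) * (3 * d + 1)"
        by (cases "d \<ge> 1"; force intro: mult_nonneg_nonneg mult_nonpos_nonpos)
          (cases "d \<le> - 1"; force intro: mult_nonneg_nonneg mult_nonpos_nonpos)
      then have "0 \<le> real_of_int ((d - 1) * (3 * d - 1))" "0 \<le> real_of_int ((d + 1) * (3 * d + 1))"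
        by (simp_all only: of_int_0_le_iff)
      then show "(real_of_int d)\<^sup>2 \<le> 4 * (real_of_int d - 1 / 2)\<^sup>2" "(real_of_int d)\<^sup>2 \<le> 4 * (real_of_int d + 1 / 2)\<^sup>2"
        by (simp_all add: power2_eq_square algebra_simps)
    qed
    have "(real_of_int c)\<^sup>2 + (real_of_int d - 1 / 2)\<^sup>2 \<le> M * (norm (w - 1 / 2))\<^sup>2"
      "(real_of_int c)\<^sup>2 + (real_of_int d + 1 / 2)\<^sup>2 \<le> M * (norm (w + 1 / 2))\<^sup>2"
      using M(2)[of "real_of_int c" "real_of_int d - 1 / 2"] M(2)[of "real_of_int c" "real_of_int d + 1 / 2"]
      by (simp_all add: w_def algebra_simps)
    then have "s \<le> 4 * (M * (norm (w - 1 / 2))\<^sup>2)" "s \<le> 4 * (M * (norm (w + 1 / 2))\<^sup>2)"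
      using d1 zero_le_power2[of "real_of_int c"] unfolding s_def by linarith+
    then have "s * s \<le> (4 * (M * (norm (w - 1 / 2))\<^sup>2)) * (4 * (M * (norm (w + 1 / 2))\<^sup>2))"
      using s by (intro mult_mono) auto
    also have "\<dots> = (4 * M * norm ((w - 1 / 2) * (w + 1 / 2)))\<^sup>2"
      unfolding norm_mult by algebra
    also have "(w - 1 / 2) * (w + 1 / 2) = w\<^sup>2 - 1 / 4"
      by (simp add: power2_eq_square algebra_simps)
    finally have "s \<le> 4 * M * norm (w\<^sup>2 - 1 / 4)"
      using M(1) by (intro power2_le_imp_le[of s]) (auto simp: power2_eq_square)
    then show "norm (1 / ((of_int c * z + of_int d)\<^sup>2 - 1 / 4)) \<le> 4 * M / ((real_of_int c)\<^sup>2 + (real_of_int d)\<^sup>2)"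
      unfolding w_def[symmetric] s_def[symmetric] using s nz
      by (simp add: norm_divide field_simps)
  qed
qed

lemma add_lower_bounds:
  fixes x y :: real
  assumes "1 \<le> x" "0 \<le> y"
  shows "1 + x \<le> 2 * (x + y)" "1 + y \<le> x + y"
  using assms by simp_all

text \<open>With \<open>x = c^2\<close> and \<open>y = d^2\<close> the bound factors, so a product
  of two convergent single series dominates the double series.\<close>

lemma inverse_square_bound:
  fixes x y :: real
  assumes "1 \<le> x" "0 \<le> y"
  shows "1 / (x + y)\<^sup>2 \<le> 2 * (1 / (1 + x) * (1 / (1 + y)))"
proof -
  define p q s where "p = 1 + x" and "q = 1 + y" and "s = x + y"
  have "0 < p" "0 < q" "0 < s" using assms by (auto simp: p_def q_def s_def)
  moreover have "p * q \<le> (2 * s) * s"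
    using add_lower_bounds[OF assms] assms unfolding p_def q_def s_def by (intro mult_mono) auto
  ultimately have "1 / s\<^sup>2 \<le> 2 * (1 / p * (1 / q))"
    by (simp add: field_simps power2_eq_square)
  then show ?thesis by (simp only: p_def q_def s_def)
qed

lemma inverse_bound:
  fixes x y :: real
  assumes "1 \<le> x" "0 \<le> y"
  shows "1 / (x + y) \<le> 2 * (1 / (1 + x))"
proof -
  define p s where "p = 1 + x" and "s = x + y"
  have "0 < p" "0 < s" using assms by (auto simp: p_def s_def)
  moreover have "p \<le> 2 * s"
    using add_lower_bounds[OF assms] unfolding p_def s_def by simp
  ultimately have "1 / s \<le> 2 * (1 / p)"
    by (simp add: field_simps)
  then show ?thesis by (simp only: p_def s_def)
qed

text \<open>The difference equals \<open>- 1/4\<close> times the product of the two terms, so it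
  decays like the fourth power of the inverse norm.\<close>

lemma summable_lattice_difference:
  assumes "Im z \<noteq> 0"
  shows "(\<lambda>(c, d). 1 / (of_int c * z + of_int d)\<^sup>2 - 1 / ((of_int c * z + of_int d)\<^sup>2 - 1 / 4))
    summable_on {c :: int. c \<noteq> 0} \<times> (UNIV :: int set)"
proof -
  obtain K where K: "0 < K"
    "\<And>c d :: int. c \<noteq> 0 \<Longrightarrow>
      norm (1 / (of_int c * z + of_int d)\<^sup>2) \<le> K / ((real_of_int c)\<^sup>2 + (real_of_int d)\<^sup>2)"
    "\<And>c d :: int. c \<noteq> 0 \<Longrightarrow>
      norm (1 / ((of_int c * z + of_int d)\<^sup>2 - 1 / 4)) \<le> K / ((real_of_int c)\<^sup>2 + (real_of_int d)\<^sup>2)"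
    using lattice_term_bounds[OF assms] by blast
  define b where "b = (\<lambda>c :: int. 1 / (1 + (real_of_int c)\<^sup>2))"
  have b: "b summable_on UNIV" unfolding b_def by (rule summable_on_int_inverse_square)
  have "(\<lambda>(c, d). b c * b d) summable_on UNIV \<times> UNIV"
  proof (rule summable_on_SigmaI)
    fix c show "((\<lambda>d. case (c, d) of (c, d) \<Rightarrow> b c * b d) has_sum b c * infsum b UNIV) UNIV"
      using b by (simp add: has_sum_cmult_right)
    show "(\<lambda>c. b c * infsum b UNIV) summable_on UNIV"
      using b by (rule summable_on_cmult_left)
  qed (auto simp: b_def)
  then have "(\<lambda>(c, d). b c * b d) summable_on {c. c \<noteq> 0} \<times> UNIV"
    by (rule summable_on_subset) auto
  then have sb: "(\<lambda>x. K\<^sup>2 / 2 * (case x of (c, d) \<Rightarrow> b c * b d)) summable_on {c. c \<noteq> 0} \<times> UNIV"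
    by (rule summable_on_cmult_right)
  have "norm (1 / (of_int c * z + of_int d)\<^sup>2 - 1 / ((of_int c * z + of_int d)\<^sup>2 - 1 / 4)) \<le> K\<^sup>2 / 2 * (b c * b d)"
    if c: "c \<noteq> 0" for c d :: int
  proof -
    define w where "w = of_int c * z + of_int d"
    define s where "s = (real_of_int c)\<^sup>2 + (real_of_int d)\<^sup>2"
    note nz = lattice_not_half_integer[OF assms c, of d, folded w_def]
    have "1 \<le> c\<^sup>2" using c by (simp add: int_one_le_iff_zero_less)
    then have c2: "1 \<le> (real_of_int c)\<^sup>2" by (metis of_int_1_le_iff of_int_power)
    have s: "0 < s" using c by (simp add: s_def add_pos_nonneg)
    have "1 / x - 1 / (x - 1 / 4) = - 1 / 4 * ((1 / x) * (1 / (x - 1 / 4)))"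
      if "x \<noteq> 0" "x - 1 / 4 \<noteq> 0" for x :: complex
      using that by (simp add: divide_simps)
    from this[of "w\<^sup>2"] nz have "norm (1 / w\<^sup>2 - 1 / (w\<^sup>2 - 1 / 4)) = 1 / 4 * (norm (1 / w\<^sup>2) * norm (1 / (w\<^sup>2 - 1 / 4)))"
      by (simp add: norm_mult norm_divide)
    also have "\<dots> \<le> 1 / 4 * ((K / s) * (K / s))"
      using K(2)[OF c, of d] K(3)[OF c, of d] K(1) s
      by (intro mult_left_mono mult_mono) (auto simp: w_def s_def)
    also have "\<dots> = K\<^sup>2 / 4 * (1 / s\<^sup>2)" by (simp add: power2_eq_square)
    also have "\<dots> \<le> K\<^sup>2 / 4 * (2 * (b c * b d))"
      using inverse_square_bound[OF c2 zero_le_power2] unfolding b_def s_def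
      by (intro mult_left_mono) auto
    finally show ?thesis
      by (simp add: w_def algebra_simps)
  qed
  then have "(\<lambda>x. norm (case x of (c, d) \<Rightarrow> 1 / (of_int c * z + of_int d)\<^sup>2 - 1 / ((of_int c * z + of_int d)\<^sup>2 - 1 / 4)))
      summable_on {c :: int. c \<noteq> 0} \<times> (UNIV :: int set)"
    by (intro Infinite_Sum.abs_summable_on_comparison_test'[OF sb]) auto
  then show ?thesis by (rule abs_summable_summable)
qed

lemma has_sum_diff:
  fixes f g :: "'a \<Rightarrow> 'b :: real_normed_vector"
  assumes "(f has_sum S) A" "(g has_sum T) A"
  shows "((\<lambda>x. f x - g x) has_sum (S - T)) A"
  using has_sum_add[OF assms(1), of "\<lambda>x. - g x" "- T"] assms(2) by (simp add: has_sum_uminus)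

lemma has_sum_sum:
  fixes f :: "'a \<Rightarrow> 'b \<Rightarrow> 'c :: topological_comm_monoid_add"
  assumes "finite D" "\<And>d. d \<in> D \<Longrightarrow> (f d has_sum S d) A"
  shows "((\<lambda>x. \<Sum>d\<in>D. f d x) has_sum (\<Sum>d\<in>D. S d)) A"
  using assms by (induction D rule: finite_induct) (auto intro!: has_sum_add)

lemma sum_telescope_symmetric:
  fixes b :: "int \<Rightarrow> 'a :: ab_group_add"
  shows "(\<Sum>d\<in>{- int N..int N}. b d - b (d + 1)) = b (- int N) - b (int N + 1)"
proof (induction N)
  case (Suc N)
  have "{- int (Suc N)..int (Suc N)} = insert (- int (Suc N)) (insert (int (Suc N)) {- int N..int N})"
    by auto
  then show ?case using Suc.IH by (simp add: algebra_simps)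
qed simp

lemma tendsto_inverse_of_nat_plus: "(\<lambda>n. 1 / (of_nat n + c :: complex)) \<longlonglongrightarrow> 0"
  by (rule tendsto_divide_0[OF tendsto_const])
     (intro tendsto_add_filterlim_at_infinity'[OF tendsto_of_nat tendsto_const])

text \<open>Hence subtracting the comparison terms changes no row sum; their effect shows only in
  the columns.\<close>

lemma has_sum_row_telescoping:
  assumes z: "Im z \<noteq> 0" and c: "c \<noteq> 0"
  shows "((\<lambda>d :: int. 1 / ((of_int c * z + of_int d)\<^sup>2 - 1 / 4)) has_sum 0) UNIV"
proof -
  define b where "b = (\<lambda>d :: int. 1 / (of_int c * z + of_int d - 1 / 2))"
  have b: "1 / ((of_int c * z + of_int d)\<^sup>2 - 1 / 4) = b d - b (d + 1)" for d
    unfolding telescoping_term[OF z c] by (simp add: b_def algebra_simps)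
  obtain K where K: "0 < K"
    and bound: "\<And>c d :: int. c \<noteq> 0 \<Longrightarrow>
      norm (1 / ((of_int c * z + of_int d)\<^sup>2 - 1 / 4)) \<le> K / ((real_of_int c)\<^sup>2 + (real_of_int d)\<^sup>2)"
    by (rule lattice_term_bounds[OF z], rule that)
  have "1 \<le> c\<^sup>2" using c by (simp add: int_one_le_iff_zero_less)
  then have c2: "1 \<le> (real_of_int c)\<^sup>2" by (metis of_int_1_le_iff of_int_power)
  have "(\<lambda>d :: int. K * (1 / (1 + (real_of_int d)\<^sup>2))) summable_on UNIV"
    by (intro summable_on_cmult_right summable_on_int_inverse_square)
  then have "(\<lambda>d. norm (b d - b (d + 1))) summable_on UNIV"
  proof (rule Infinite_Sum.abs_summable_on_comparison_test')
    fix d :: int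
    have "norm (b d - b (d + 1)) \<le> K / ((real_of_int c)\<^sup>2 + (real_of_int d)\<^sup>2)"
      using bound[OF c, of d] unfolding b .
    also have "\<dots> \<le> K * (1 / (1 + (real_of_int d)\<^sup>2))"
      using K c2 by (simp add: frac_le add_pos_nonneg)
    finally show "norm (b d - b (d + 1)) \<le> K * (1 / (1 + (real_of_int d)\<^sup>2))" .
  qed
  moreover have "(\<lambda>n. b (int n)) \<longlonglongrightarrow> 0"
    using tendsto_inverse_of_nat_plus[of "of_int c * z - 1 / 2"] by (simp add: b_def algebra_simps)
  moreover have "(\<lambda>n. b (- int n)) \<longlonglongrightarrow> 0"
  proof -
    have "1 / (of_int c * z - of_nat n - 1 / 2) = - (1 / (of_nat n + (1 / 2 - of_int c * z)))" for n
      by (subst minus_divide_right) simp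
    then show ?thesis
      using tendsto_minus[OF tendsto_inverse_of_nat_plus[of "1 / 2 - of_int c * z"]] by (simp add: b_def)
  qed
  ultimately show ?thesis
    unfolding b by (intro has_sum_telescope_int)
qed

lemma summable_column_telescoping:
  assumes z: "Im z \<noteq> 0"
  shows "(\<lambda>c :: int. 1 / ((of_int c * z + of_int d)\<^sup>2 - 1 / 4)) summable_on {c. c \<noteq> 0}"
proof -
  obtain K where K: "0 < K"
    and bound: "\<And>c d :: int. c \<noteq> 0 \<Longrightarrow>
      norm (1 / ((of_int c * z + of_int d)\<^sup>2 - 1 / 4)) \<le> K / ((real_of_int c)\<^sup>2 + (real_of_int d)\<^sup>2)"
    by (rule lattice_term_bounds[OF z], rule that)
  have "(\<lambda>c :: int. 2 * K * (1 / (1 + (real_of_int c)\<^sup>2))) summable_on UNIV"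
    by (intro summable_on_cmult_right summable_on_int_inverse_square)
  then have "(\<lambda>c :: int. 2 * K * (1 / (1 + (real_of_int c)\<^sup>2))) summable_on {c. c \<noteq> 0}"
    by (rule summable_on_subset) auto
  then have "(\<lambda>c :: int. norm (1 / ((of_int c * z + of_int d)\<^sup>2 - 1 / 4))) summable_on {c. c \<noteq> 0}"
  proof (rule Infinite_Sum.abs_summable_on_comparison_test')
    fix c :: int assume "c \<in> {c. c \<noteq> 0}"
    then have c: "c \<noteq> 0" by simp
    have "1 \<le> c\<^sup>2" using c by (simp add: int_one_le_iff_zero_less)
    then have c2: "1 \<le> (real_of_int c)\<^sup>2" by (metis of_int_1_le_iff of_int_power)
    have "norm (1 / ((of_int c * z + of_int d)\<^sup>2 - 1 / 4)) \<le> K * (1 / ((real_of_int c)\<^sup>2 + (real_of_int d)\<^sup>2))"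
      using bound[OF c, of d] by simp
    also have "\<dots> \<le> K * (2 * (1 / (1 + (real_of_int c)\<^sup>2)))"
      using inverse_bound[OF c2 zero_le_power2] K by (intro mult_left_mono) auto
    finally show "norm (1 / ((of_int c * z + of_int d)\<^sup>2 - 1 / 4)) \<le> 2 * K * (1 / (1 + (real_of_int c)\<^sup>2))"
      by (simp only: mult_ac)
  qed
  then show ?thesis by (rule abs_summable_summable)
qed

text \<open>For fixed \<open>c\<close> the sum over \<open>d\<close> telescopes to
  \<open>1 / (c z - x N) - 1 / (c z + x N)\<close>. This is even in \<open>c\<close>, and for
  positive \<open>c\<close> it is \<open>1 / z\<close> times a term of
  \<open>cot_partial_fractions\<close> at \<open>t = x N / z\<close>.\<close>

lemma symmetric_telescoping_sum:
  assumes z: "Im z \<noteq> 0"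
  defines "x \<equiv> \<lambda>N. of_nat N + 1 / 2 :: complex"
  shows "((\<lambda>c :: int. \<Sum>d\<in>{- int N..int N}. 1 / ((of_int c * z + of_int d)\<^sup>2 - 1 / 4)) has_sum
    (2 / z * (z / x N - of_real pi * cot (of_real pi * (x N / z))))) {c. c \<noteq> 0}"
    (is "(?F has_sum _) _")
proof -
  have zn: "z \<noteq> 0" using z by (cases "z = 0") auto
  have xr: "x N = of_real (real N + 1 / 2)" by (simp add: x_def)
  have xn: "x N \<noteq> 0" unfolding xr of_real_eq_0_iff by linarith
  define t where "t = x N / z"
  have "Im t = - ((real N + 1 / 2) * Im z / ((Re z)\<^sup>2 + (Im z)\<^sup>2))"
    by (simp add: t_def xr Im_divide)
  then have "Im t \<noteq> 0" using z by (simp add: sum_power2_eq_zero_iff)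
  then have t: "t \<notin> \<int>" by (auto elim: Ints_cases)
  have F: "?F c = 1 / (of_int c * z - x N) - 1 / (of_int c * z + x N)" if "c \<noteq> 0" for c :: int
  proof -
    define b where "b = (\<lambda>d :: int. 1 / (of_int c * z + of_int d - 1 / 2))"
    have b: "1 / ((of_int c * z + of_int d)\<^sup>2 - 1 / 4) = b d - b (d + 1)" for d
      unfolding telescoping_term[OF z that] by (simp add: b_def algebra_simps)
    show ?thesis
      unfolding b sum_telescope_symmetric by (simp add: b_def x_def algebra_simps)
  qed
  have "?F summable_on {c. c \<noteq> 0}"
    by (rule has_sum_imp_summable, rule has_sum_sum, simp, rule has_sum_infsum,
        rule summable_column_telescoping[OF z])
  then have "?F summable_on int ` {1..}"
    by (rule summable_on_subset) auto
  then have "(\<lambda>n. ?F (int n)) summable_on {1..}"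
    by (subst (asm) summable_on_reindex) (auto simp: o_def)
  then obtain S where S: "((\<lambda>n. ?F (int n)) has_sum S) {1..}"
    by (auto simp: summable_on_def)
  have "bij_betw Suc UNIV {1..}"
    by (rule bij_betwI[where g = "\<lambda>n. n - 1"]) auto
  then have "((\<lambda>n. ?F (int (Suc n))) has_sum S) UNIV"
    using has_sum_reindex_bij_betw[of Suc UNIV "{1..}" "\<lambda>n. ?F (int n)"] S by blast
  then have "(\<lambda>n. ?F (int (Suc n))) sums S"
    by (rule has_sum_imp_sums)
  moreover have "(\<lambda>n. ?F (int (Suc n))) sums (1 / z * (1 / t - of_real pi * cot (of_real pi * t)))"
  proof -
    have "?F (int (Suc n)) = 1 / z * (1 / (of_nat (Suc n) - t) - 1 / (of_nat (Suc n) + t))" for n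
    proof -
      have "z * (of_nat (Suc n) - t) = of_int (int (Suc n)) * z - x N"
        "z * (of_nat (Suc n) + t) = of_int (int (Suc n)) * z + x N"
        using zn by (simp_all add: t_def algebra_simps)
      moreover have "1 / z * (1 / a - 1 / b) = 1 / (z * a) - 1 / (z * b)" for a b
        by (simp add: right_diff_distrib)
      moreover have "int (Suc n) \<noteq> 0" by simp
      note F[OF this]
      ultimately show ?thesis by (simp only:)
    qed
    then show ?thesis using sums_mult[OF cot_partial_fractions[OF t], of "1 / z"] by simp
  qed
  ultimately have "S = 1 / z * (1 / t - of_real pi * cot (of_real pi * t))"
    by (rule sums_unique2)
  then have "S + S = 2 / z * (z / x N - of_real pi * cot (of_real pi * (x N / z)))"
    by (simp add: t_def)
  moreover have "((\<lambda>c. if c = 0 then 0 else ?F c) has_sum (S + S)) {c. c \<noteq> 0}"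
  proof (rule has_sum_nonzero_int_even)
    show "(if - c = 0 then 0 else ?F (- c)) = (if c = 0 then 0 else ?F c)" for c :: int
    proof (cases "c = 0")
      case False
      have "1 / (of_int (- c) * z - x N) = - (1 / (of_int c * z + x N))"
        "1 / (of_int (- c) * z + x N) = - (1 / (of_int c * z - x N))"
        by (simp_all add: minus_divide_right)
      with False show ?thesis by (simp only: F) (simp add: F)
    qed simp
    show "((\<lambda>n. if int n = 0 then 0 else ?F (int n)) has_sum S) {1..}"
      using S by (rule has_sum_cong[THEN iffD1, rotated]) auto
  qed
  then have "(?F has_sum (S + S)) {c. c \<noteq> 0}"
    by (rule has_sum_cong[THEN iffD1, rotated]) auto
  ultimately show ?thesis
    by simp
qed

text \<open>As \<open>N\<close> grows, \<open>- (N + 1/2) / z\<close> moves up the half-plane, so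
  its nome tends to 0 and the cotangent to \<open>\<i>\<close>.\<close>

lemma symmetric_telescoping_limit:
  assumes z: "z \<in> upper_half_plane"
  shows "(\<lambda>N. 2 / z * (z / (of_nat N + 1 / 2) - of_real pi * cot (of_real pi * ((of_nat N + 1 / 2) / z))))
    \<longlonglongrightarrow> - (2 * of_real pi * \<i> / z)"
proof -
  define y where "y = - 1 / z"
  have y: "y \<in> upper_half_plane" using upper_half_plane_minus_inverse[OF z] by (simp add: y_def)
  have eq: "nome (- ((of_nat N + 1 / 2) / z)) = nome (y / 2) * nome y ^ N" for N
  proof -
    have "- ((of_nat N + 1 / 2) / z) = y / 2 + of_nat N * y"
      by (simp add: y_def add_divide_distrib)
    then show ?thesis
      by (simp add: nome_def exp_add ring_distribs exp_of_nat_mult mult_ac)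
         (simp add: exp_of_nat_mult [symmetric] mult_ac)
  qed
  have lim: "(\<lambda>N. nome (y / 2) * nome y ^ N) \<longlonglongrightarrow> nome (y / 2) * 0"
    by (intro tendsto_intros LIMSEQ_power_zero norm_nome_less_1 y)
  have "(\<lambda>N. 2 / z * (z * (1 / (of_nat N + 1 / 2)) - of_real pi *
      (\<i> * (1 + nome (y / 2) * nome y ^ N) / (1 - nome (y / 2) * nome y ^ N))))
    \<longlonglongrightarrow> 2 / z * (z * 0 - of_real pi * (\<i> * (1 + nome (y / 2) * 0) / (1 - nome (y / 2) * 0)))"
    by (intro tendsto_intros lim tendsto_inverse_of_nat_plus) simp
  then show ?thesis
    unfolding cot_eq_nome eq by (simp add: mult.assoc)
qed

text \<open>\<open>S\<close> is the double sum of \<open>g - a\<close>. By rows it involves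
  \<open>E2 z\<close>; by columns it is \<open>V\<close>, which involves
  \<open>E2 (- 1 / z)\<close>, minus the sum of the \<open>r d\<close>. So \<open>V - S\<close> is
  the limit of the symmetric telescoping sums.\<close>

theorem E2_inversion:
  assumes z: "z \<in> upper_half_plane"
  shows "E2 (- 1 / z) = z\<^sup>2 * E2 z + 6 * z / (of_real pi * \<i>)"
proof -
  have Imz: "Im z \<noteq> 0" using z by (simp add: upper_half_plane_def)
  note y = upper_half_plane_minus_inverse[OF z]
  define g where "g = (\<lambda>c d :: int. 1 / (of_int c * z + of_int d)\<^sup>2)"
  define a where "a = (\<lambda>c d :: int. 1 / ((of_int c * z + of_int d)\<^sup>2 - 1 / 4))"
  define C where "C = {c :: int. c \<noteq> 0}"
  define r where "r = (\<lambda>d. infsum (\<lambda>c. a c d) C)"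
  define s where "s = (\<lambda>t. of_real pi ^ 2 / sin (of_real pi * t) ^ 2 :: complex)"
  \<comment> \<open>Column sums of \<open>g\<close> over nonzero \<open>c\<close>: for
    \<open>d = 0\<close> twice \<open>zeta(2) / z^2\<close>; otherwise the sum over all integers
    \<open>c\<close>, minus the term \<open>c = 0\<close>. As \<open>s\<close> is even, its argument
    may be written with \<open>- 1 / z\<close>.\<close>
  define v where "v = (\<lambda>d :: int. if d = 0 then of_real pi ^ 2 / 3 / z\<^sup>2
    else s (of_int d * (- 1 / z)) / z\<^sup>2 - 1 / (of_int d)\<^sup>2)"
  obtain S where S: "((\<lambda>(c, d). g c d - a c d) has_sum S) (C \<times> UNIV)"
    using summable_lattice_difference[OF Imz] by (auto simp: summable_on_def g_def a_def C_def)
  have "((\<lambda>c. s (of_int c * z)) has_sum S) C"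
  proof (rule has_sum_SigmaD[OF S])
    fix c assume "c \<in> C"
    then have c: "c \<noteq> 0" by (simp add: C_def)
    have "((\<lambda>d. g c d) has_sum s (of_int c * z)) UNIV"
      unfolding g_def s_def using c Imz by (intro has_sum_inverse_squares_int) auto
    from has_sum_diff[OF this has_sum_row_telescoping[OF Imz c]]
    show "((\<lambda>d. case (c, d) of (c, d) \<Rightarrow> g c d - a c d) has_sum s (of_int c * z)) UNIV"
      by (simp add: a_def)
  qed
  moreover have "((\<lambda>c. s (of_int c * z)) has_sum (of_real pi ^ 2 / 3 * (E2 z - 1))) C"
    unfolding s_def C_def by (rule has_sum_rows_E2[OF z])
  ultimately have S_eq: "S = of_real pi ^ 2 / 3 * (E2 z - 1)"
    by (rule has_sum_unique)

  have rs: "((\<lambda>c. a c d) has_sum r d) C" for d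
    unfolding r_def a_def C_def by (intro has_sum_infsum summable_column_telescoping Imz)
  have vs: "((\<lambda>c. g c d) has_sum v d) C" for d
  proof (cases "d = 0")
    case True
    from has_sum_cmult_right[OF has_sum_inverse_squares_nonzero_int, of "1 / z\<^sup>2"]
    show ?thesis using True by (simp add: g_def v_def C_def power_mult_distrib mult_ac)
  next
    case False
    have "Im (of_int d / z) \<noteq> 0"
      using False Imz by (simp add: Im_divide sum_power2_eq_zero_iff)
    then have "((\<lambda>c :: int. 1 / z\<^sup>2 * (1 / (of_int d / z + of_int c)\<^sup>2)) has_sum (1 / z\<^sup>2 * s (of_int d / z))) UNIV"
      unfolding s_def by (intro has_sum_cmult_right has_sum_inverse_squares_int)
    moreover have "1 / z\<^sup>2 * (1 / (of_int d / z + of_int c)\<^sup>2) = g c d" for c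
    proof -
      have "z * (of_int d / z + of_int c) = of_int c * z + of_int d"
        using y(2) by (simp add: ring_distribs)
      then show ?thesis by (simp add: g_def flip: power_mult_distrib)
    qed
    ultimately have "((\<lambda>c. g c d) has_sum (1 / z\<^sup>2 * s (of_int d / z))) UNIV"
      by simp
    then have "((\<lambda>c. g c d) has_sum (1 / z\<^sup>2 * s (of_int d / z) - g 0 d)) (UNIV - {0})"
      by (rule has_sum_Diff) (auto intro: has_sum_finiteI)
    moreover have "s (of_int d * (- 1 / z)) = s (of_int d / z)"
      by (simp add: s_def)
    ultimately show ?thesis
      using False by (simp add: v_def g_def C_def Compl_eq_Diff_UNIV[symmetric] Collect_neg_eq)
  qed
  have "((\<lambda>(d, c). g c d - a c d) has_sum S) (UNIV \<times> C)"
    using S by (subst has_sum_swap) simp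
  then have vr: "((\<lambda>d. v d - r d) has_sum S) UNIV"
    by (rule has_sum_SigmaD) (auto intro!: has_sum_diff vs rs)
  \<comment> \<open>Column \<open>d = 0\<close> plus all others; it simplifies to
    \<open>pi^2 / 3 * (E2 (- 1 / z) / z^2 - 1)\<close>.\<close>
  define V where "V = of_real pi ^ 2 / 3 / z\<^sup>2 + ((of_real pi ^ 2 / 3 * (E2 (- 1 / z) - 1)) / z\<^sup>2 - of_real pi ^ 2 / 3)"
  have "(v has_sum V) UNIV"
  proof -
    have "((\<lambda>d. s (of_int d * (- 1 / z)) / z\<^sup>2 - 1 / (of_int d)\<^sup>2) has_sum
        ((of_real pi ^ 2 / 3 * (E2 (- 1 / z) - 1)) / z\<^sup>2 - of_real pi ^ 2 / 3)) C"
      unfolding s_def C_def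
      by (intro has_sum_diff has_sum_divide_const has_sum_rows_E2 has_sum_inverse_squares_nonzero_int y)
    then have "(v has_sum ((of_real pi ^ 2 / 3 * (E2 (- 1 / z) - 1)) / z\<^sup>2 - of_real pi ^ 2 / 3)) C"
      by (rule has_sum_cong[THEN iffD1, rotated]) (auto simp: v_def C_def)
    then have "(v has_sum (v 0 + ((of_real pi ^ 2 / 3 * (E2 (- 1 / z) - 1)) / z\<^sup>2 - of_real pi ^ 2 / 3))) (insert 0 C)"
      by (rule has_sum_insert[rotated]) (simp add: C_def)
    moreover have "insert 0 C = UNIV" by (auto simp: C_def)
    ultimately show ?thesis by (simp add: V_def v_def)
  qed
  from has_sum_diff[OF this vr] have "(r has_sum (V - S)) UNIV"
    by simp
  then have "(\<lambda>N. \<Sum>d\<in>{- int N..int N}. r d) \<longlonglongrightarrow> V - S"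
    by (rule has_sum_int_imp_symmetric_limit)
  \<comment> \<open>The finite sum over \<open>d\<close> is moved inside the sum over
    \<open>c\<close>, where it telescopes.\<close>
  moreover have "(\<Sum>d\<in>{- int N..int N}. r d) =
      2 / z * (z / (of_nat N + 1 / 2) - of_real pi * cot (of_real pi * ((of_nat N + 1 / 2) / z)))" for N
  proof (rule has_sum_unique)
    show "((\<lambda>c. \<Sum>d\<in>{- int N..int N}. a c d) has_sum (\<Sum>d\<in>{- int N..int N}. r d)) C"
      by (intro has_sum_sum rs) simp
    show "((\<lambda>c. \<Sum>d\<in>{- int N..int N}. a c d) has_sum
        (2 / z * (z / (of_nat N + 1 / 2) - of_real pi * cot (of_real pi * ((of_nat N + 1 / 2) / z))))) C"
      unfolding a_def C_def by (rule symmetric_telescoping_sum[OF Imz])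
  qed
  ultimately have "V - S = - (2 * of_real pi * \<i> / z)"
    using symmetric_telescoping_limit[OF z] LIMSEQ_unique by simp
  moreover define X where "X = E2 (- 1 / z) / z\<^sup>2 - E2 z"
  moreover define P where "P = complex_of_real pi"
  moreover have "V - S = P\<^sup>2 / 3 * X"
    by (simp add: V_def S_eq X_def P_def algebra_simps diff_divide_distrib)
  ultimately have "P\<^sup>2 / 3 * X = - (2 * P * \<i> / z)"
    by simp
  moreover have P: "P \<noteq> 0" by (simp add: P_def)
  then have "X = 3 / P\<^sup>2 * (P\<^sup>2 / 3 * X)" by simp
  ultimately have "X = - (6 * \<i> / (P * z))"
    using P by (simp add: power2_eq_square)
  moreover have "E2 (- 1 / z) = z\<^sup>2 * E2 z + z\<^sup>2 * X"
    using y(2) by (simp add: X_def field_simps)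
  moreover have "z\<^sup>2 * - (6 * \<i> / (P * z)) = 6 * z / (P * \<i>)"
    using P y(2) by (simp add: field_simps power2_eq_square)
  ultimately show ?thesis by (simp add: P_def)
qed

subsection \<open>The discriminant function\<close>

definition euler_phi :: "complex \<Rightarrow> complex" where
  "euler_phi q = (\<Prod>n. 1 - q ^ Suc n)"

lemma euler_phi_convergent:
  fixes q :: complex
  assumes "norm q < 1"
  shows "convergent_prod (\<lambda>n. 1 - q ^ Suc n)"
proof -
  have "summable (\<lambda>n. norm (- (q ^ Suc n)))"
    using assms by (auto simp: norm_power norm_mult intro!: summable_mult summable_geometric)
  then have "abs_convergent_prod (\<lambda>n. 1 + - (q ^ Suc n))"
    by (subst abs_convergent_prod_conv_summable) simp
  then show ?thesis
    by (simp add: abs_convergent_prod_imp_convergent_prod)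
qed

lemma euler_phi_nonzero:
  assumes "norm q < 1"
  shows "euler_phi q \<noteq> 0"
  unfolding euler_phi_def
proof (rule prodinf_nonzero[OF euler_phi_convergent[OF assms]])
  fix n
  have "norm (q ^ Suc n) < 1"
    using assms by (auto simp: norm_power power_less_one_iff simp del: power_Suc)
  then show "1 - q ^ Suc n \<noteq> 0" by auto
qed

lemma euler_phi_uniform_limit:
  assumes r: "0 < r" "r < 1"
  shows "uniform_limit (ball 0 r) (\<lambda>N q. \<Prod>n<N. 1 - q ^ Suc n) euler_phi sequentially"
proof -
  have "uniformly_convergent_on (cball 0 r) (\<lambda>N q :: complex. \<Prod>n<N. 1 - q ^ Suc n)"
  proof (rule uniformly_convergent_on_prod')
    show "uniformly_convergent_on (cball 0 r) (\<lambda>N q :: complex. \<Sum>n<N. norm (1 - q ^ Suc n - 1))"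
    proof (rule Weierstrass_m_test')
      show "summable (\<lambda>n. r ^ Suc n)"
        using r by (auto intro!: summable_mult summable_geometric)
      show "norm (norm (1 - q ^ Suc n - 1)) \<le> r ^ Suc n" if "q \<in> cball 0 r" for n and q :: complex
        using that r by (auto simp: norm_power norm_mult intro!: mult_mono power_mono)
    qed
  qed (auto intro!: continuous_intros)
  then have "uniform_limit (cball 0 r) (\<lambda>N q :: complex. \<Prod>n<N. 1 - q ^ Suc n)
      (\<lambda>q. lim (\<lambda>N. \<Prod>n<N. 1 - q ^ Suc n)) sequentially"
    by (simp add: uniformly_convergent_uniform_limit_iff)
  moreover have lim: "lim (\<lambda>N. \<Prod>n<N. 1 - q ^ Suc n) = euler_phi q" if "q \<in> cball 0 r" for q :: complex
    unfolding euler_phi_def using that r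
    by (intro limI has_prod_imp_tendsto' convergent_prod_has_prod euler_phi_convergent) auto
  ultimately have "uniform_limit (cball 0 r) (\<lambda>N q :: complex. \<Prod>n<N. 1 - q ^ Suc n) euler_phi sequentially"
    by (subst (asm) uniform_limit_cong'[OF refl lim])
  then show ?thesis
    by (rule uniform_limit_on_subset) auto
qed

text \<open>Locally uniform convergence permits termwise logarithmic differentiation; the factor
  \<open>q\<close> makes the terms the rows of \<open>lambert 1 q\<close>.\<close>

lemma euler_phi_has_field_derivative:
  assumes q: "norm q < 1"
  obtains D where "(euler_phi has_field_derivative D) (at q)"
    "q * D = - lambert 1 q * euler_phi q"
proof -
  define r where "r = (1 + norm q) / 2"
  have r: "0 < r" "r < 1" "q \<in> ball 0 r" using q by (auto simp: r_def add_pos_nonneg)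
  have "euler_phi holomorphic_on ball 0 r"
  proof (rule holomorphic_uniform_sequence)
    fix x :: complex assume "x \<in> ball 0 r"
    then obtain d where "0 < d" "cball x d \<subseteq> ball 0 r"
      using open_contains_cball by blast
    then show "\<exists>d>0. cball x d \<subseteq> ball 0 r \<and>
        uniform_limit (cball x d) (\<lambda>N q. \<Prod>n<N. 1 - q ^ Suc n) euler_phi sequentially"
      using euler_phi_uniform_limit[OF r(1,2)] uniform_limit_on_subset by blast
  qed (auto intro!: holomorphic_intros)
  then have D: "(euler_phi has_field_derivative deriv euler_phi q) (at q)"
    using r(3) by (intro holomorphic_derivI) auto
  have d: "deriv (\<lambda>q. 1 - q ^ Suc n) q = - (of_nat (Suc n) * q ^ n)" for n
    by (rule DERIV_imp_deriv, rule DERIV_cong[OF DERIV_diff[OF DERIV_const DERIV_power_Suc[OF DERIV_ident]]]) simp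
  have "(\<lambda>n. deriv (\<lambda>q. 1 - q ^ Suc n) q / (1 - q ^ Suc n)) sums (deriv euler_phi q / euler_phi q)"
    using euler_phi_uniform_limit[OF r(1,2)] r(3) euler_phi_nonzero[OF q]
    by (intro logderiv_prodinf_complex_uniform_limit) (auto intro!: holomorphic_intros)
  from sums_mult[OF this, of "- q"]
  have "(\<lambda>n. of_nat (Suc n) * (q ^ Suc n / (1 - q ^ Suc n))) sums (- q * (deriv euler_phi q / euler_phi q))"
    unfolding d by (simp add: mult_ac)
  moreover have "(\<lambda>n. of_nat (Suc n) * (q ^ Suc n / (1 - q ^ Suc n))) sums lambert 1 q"
  proof (rule has_sum_imp_sums)
    have "bij_betw Suc UNIV {1..}"
      by (rule bij_betwI[where g = "\<lambda>n. n - 1"]) auto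
    then show "((\<lambda>n. of_nat (Suc n) * (q ^ Suc n / (1 - q ^ Suc n))) has_sum lambert 1 q) UNIV"
      using has_sum_reindex_bij_betw[of Suc UNIV "{1..}" "\<lambda>n. of_nat n * (q ^ n / (1 - q ^ n))"]
        lambert_has_sum_rows[OF q, of 1] by simp
  qed
  ultimately have "- q * (deriv euler_phi q / euler_phi q) = lambert 1 q"
    by (rule sums_unique2)
  then have "- (q * deriv euler_phi q) = lambert 1 q * euler_phi q"
    using euler_phi_nonzero[OF q] by (simp add: field_simps)
  then have "q * deriv euler_phi q = - lambert 1 q * euler_phi q"
    by (metis minus_minus mult_minus_left)
  with D show ?thesis by (rule that)
qed

lemma Delta_eq:
  assumes "z \<in> upper_half_plane"
  shows "Delta z = nome z * euler_phi (nome z) ^ 24"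
  unfolding Delta_def euler_phi_def
  by (simp only: prodinf_power[OF euler_phi_convergent[OF norm_nome_less_1[OF assms]]])

text \<open>The logarithmic derivative of \<open>q * euler_phi q ^ 24\<close> under
  \<open>q d/dq\<close> is \<open>1 - 24 * lambert 1 q\<close>, which is \<open>E2\<close>.\<close>

theorem Delta_has_field_derivative:
  assumes z: "z \<in> upper_half_plane"
  shows "(Delta has_field_derivative 2 * of_real pi * \<i> * (E2 z * Delta z)) (at z)"
proof -
  define q where "q = nome z"
  obtain D where D: "(euler_phi has_field_derivative D) (at q)" "q * D = - lambert 1 q * euler_phi q"
    using euler_phi_has_field_derivative norm_nome_less_1[OF z] unfolding q_def by blast
  have "((\<lambda>z. euler_phi (nome z)) has_field_derivative D * (2 * of_real pi * \<i> * nome z * 1)) (at z)"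
    using D(1) unfolding q_def by (rule DERIV_chain2) (intro derivative_intros)
  then have "((\<lambda>z. euler_phi (nome z)) has_field_derivative 2 * of_real pi * \<i> * (q * D)) (at z)"
    by (simp add: q_def mult_ac)
  then have "((\<lambda>z. nome z * euler_phi (nome z) ^ 24) has_field_derivative
      2 * of_real pi * \<i> * nome z * 1 * euler_phi (nome z) ^ 24 +
      24 * (euler_phi (nome z) ^ 23 * (2 * of_real pi * \<i> * (q * D))) * nome z) (at z)"
    by (intro DERIV_mult' derivative_eq_intros) (auto simp: mult_ac)
  also have "2 * of_real pi * \<i> * nome z * 1 * euler_phi (nome z) ^ 24 +
      24 * (euler_phi (nome z) ^ 23 * (2 * of_real pi * \<i> * (q * D))) * nome z =
      2 * of_real pi * \<i> * (E2 z * Delta z)"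
    unfolding D(2) unfolding Delta_eq[OF z] E2_eq[OF z] q_def by (simp add: eval_nat_numeral algebra_simps)
  finally show ?thesis
    by (rule has_field_derivative_transform_within_open[OF _ open_upper_half_plane z]) (simp add: Delta_eq)
qed

lemma Delta_holomorphic: "Delta holomorphic_on upper_half_plane"
  using Delta_has_field_derivative holomorphic_on_open open_upper_half_plane by blast

subsection \<open>Higher derivatives of \<open>\<Delta>\<close>\<close>

text \<open>The recursion uses only \<open>E2\<close>, \<open>E4\<close>, \<open>D_op\<close>,
  products and differences, all of which preserve expansions.\<close>

lemma calB_q_expansion: "\<exists>F. q_expansion (calB r) F"
proof (induction r rule: calB.induct)
  case 1
  show ?case using q_expansion_const[of 1] by auto
next
  case 2
  show ?case using q_expansion_const[of 0] by auto
next
  case (3 n)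
  then obtain F G where F: "q_expansion (calB (Suc n)) F" and G: "q_expansion (calB n) G" by blast
  from q_expansion_diff[OF
      q_expansion_mult[OF q_expansion_const q_expansion_diff[OF q_expansion_D_op[OF F]
        q_expansion_mult[OF q_expansion_mult[OF q_expansion_const q_expansion_E2] F]]]
      q_expansion_mult[OF q_expansion_mult[OF q_expansion_const q_expansion_E4] G]]
  show ?case
    unfolding calB.simps serre_deriv_def by blast
qed

text \<open>\<open>n!\<close> times the absolute value of the coefficient of \<open>x\<^sup>j\<close> in the Laguerre polynomial \<open>L\<^sub>n\<^bsup>(11)\<^esup>\<close>.\<close>

definition laguerre_coeff :: "nat \<Rightarrow> nat \<Rightarrow> complex" where
  "laguerre_coeff n j = fact n / fact j * of_nat ((n + 11) choose (j + 11))"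

section \<open>Recurrences of the Laguerre coefficients\<close>

lemma laguerre_coeff_eq:
  assumes "j \<le> n"
  shows "laguerre_coeff n j = fact n * fact (n + 11) / (fact j * fact (j + 11) * fact (n - j))"
  using assms by (simp add: laguerre_coeff_def binomial_fact)

lemma laguerre_coeff_above: "n < j \<Longrightarrow> laguerre_coeff n j = 0"
  by (simp add: laguerre_coeff_def)

lemma laguerre_coeff_0_0: "laguerre_coeff 0 0 = 1"
  by (simp add: laguerre_coeff_def)

lemma fact_plus_12: "fact (m + 12) = (of_nat m + 12) * (fact (m + 11) :: complex)"
  using fact_Suc[of "m + 11", where 'a = complex] by (simp add: add_ac)

text \<open>The ratio of neighbouring coefficients; it makes the \<open>E4\<close> terms cancel in
  \<open>higher_deriv_Delta\<close>.\<close>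

lemma laguerre_coeff_Suc_right:
  assumes "j \<le> n"
  shows "of_nat ((j + 1) * (j + 12)) * laguerre_coeff n (Suc j) = of_nat (n - j) * laguerre_coeff n j"
proof (cases "j = n")
  case False
  with assms have j: "Suc j \<le> n" by simp
  then obtain k where k: "n = Suc (j + k)" using less_imp_Suc_add[of j n] by auto
  define A B C where "A = (fact j :: complex)" and "B = (fact (j + 11) :: complex)" and "C = (fact k :: complex)"
  have nz: "A \<noteq> 0" "B \<noteq> 0" "C \<noteq> 0" by (simp_all add: A_def B_def C_def)
  define P u v w where "P = (fact n * fact (n + 11) :: complex)" and "u = (of_nat (j + 1) :: complex)"
    and "v = (of_nat (j + 12) :: complex)" and "w = (of_nat (n - j) :: complex)"
  have "laguerre_coeff n (Suc j) = P / ((u * A) * (v * B) * C)"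
    unfolding laguerre_coeff_eq[OF j] using fact_plus_12[of j]
    by (simp add: A_def B_def C_def P_def u_def v_def k add_ac)
  moreover have "laguerre_coeff n j = P / (A * B * (w * C))"
    unfolding laguerre_coeff_eq[OF assms] by (simp add: A_def B_def C_def P_def w_def k Suc_diff_le)
  moreover have "u \<noteq> 0" "v \<noteq> 0" "w \<noteq> 0"
    using j unfolding u_def v_def w_def of_nat_eq_0_iff by simp_all
  ultimately have "u * v * laguerre_coeff n (Suc j) = w * laguerre_coeff n j"
    using nz by simp
  then show ?thesis unfolding u_def v_def w_def by (simp only: of_nat_mult)
qed (simp add: laguerre_coeff_above)

text \<open>For \<open>j < n\<close>, clearing the common factorials leaves
  \<open>(n + 1) (n + 12) = (n + j + 13) (n - j) + (j + 1) (j + 12)\<close>.\<close>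

lemma laguerre_coeff_Suc:
  "laguerre_coeff (Suc n) (Suc j) = of_nat (n + j + 13) * laguerre_coeff n (Suc j) + laguerre_coeff n j"
proof (cases "Suc j \<le> n")
  case False
  then consider "j = n" | "n < j" by linarith
  then show ?thesis
    by cases (simp_all add: laguerre_coeff_above laguerre_coeff_eq del: fact_Suc of_nat_Suc)
next
  case True
  define A B C where "A = (fact j :: complex)" and "B = (fact (j + 11) :: complex)"
    and "C = (fact (n - Suc j) :: complex)"
  define x y where "x = (of_nat n :: complex)" and "y = (of_nat j :: complex)"
  have nz: "A \<noteq> 0" "B \<noteq> 0" "C \<noteq> 0" by (simp_all add: A_def B_def C_def)
  have sub: "of_nat (n - j) = x - y"
    using True by (simp add: x_def y_def of_nat_diff)
  have nz2: "y + 1 \<noteq> 0" "y + 12 \<noteq> 0" "x - y \<noteq> 0"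
  proof -
    have "y + 1 = of_nat (j + 1)" "y + 12 = of_nat (j + 12)" by (simp_all add: y_def)
    then show "y + 1 \<noteq> 0" "y + 12 \<noteq> 0" by (simp_all only: of_nat_eq_0_iff)
    show "x - y \<noteq> 0" using True unfolding sub[symmetric] of_nat_eq_0_iff by simp
  qed
  have nj: "n - j = Suc (n - Suc j)" using True by simp
  define P where "P = (fact n * fact (n + 11) :: complex)"
  have 1: "laguerre_coeff n (Suc j) = P / (((y + 1) * A) * ((y + 12) * B) * C)"
    unfolding laguerre_coeff_eq[OF True] using fact_plus_12[of j] by (simp add: A_def B_def C_def P_def y_def add_ac)
  have 2: "laguerre_coeff n j = P / (A * B * ((x - y) * C))"
    using True unfolding sub[symmetric] by (simp add: laguerre_coeff_eq A_def B_def C_def P_def nj)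
  have 3: "laguerre_coeff (Suc n) (Suc j) = (x + 1) * (x + 12) * P / (((y + 1) * A) * ((y + 12) * B) * ((x - y) * C))"
    using True fact_plus_12[of j] fact_plus_12[of n] unfolding sub[symmetric]
    by (simp add: laguerre_coeff_eq A_def B_def C_def P_def x_def y_def nj add_ac mult_ac)
  show ?thesis
    unfolding 1 2 3 using nz nz2
    by (simp add: divide_simps) (simp add: x_def y_def algebra_simps)
qed

lemma laguerre_coeff_Suc_0: "laguerre_coeff (Suc n) 0 = of_nat (n + 12) * laguerre_coeff n 0"
proof -
  have "laguerre_coeff m 0 = fact (m + 11) / fact 11" for m
    by (simp add: laguerre_coeff_eq)
  then show ?thesis using fact_plus_12[of n] by (simp add: add_ac)
qed

text \<open>The common induction step of both derivative formulas: differentiating the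
  \<open>j\<close>-th term yields \<open>(n + j + 12) * X j + X (Suc j)\<close>, up to terms that
  cancel.\<close>

lemma laguerre_coeff_sum_Suc:
  fixes X :: "nat \<Rightarrow> complex"
  shows "(\<Sum>j\<le>n. laguerre_coeff n j * (of_nat (n + j + 12) * X j + X (Suc j))) = (\<Sum>j\<le>Suc n. laguerre_coeff (Suc n) j * X j)"
proof -
  have "(\<Sum>j\<le>n. laguerre_coeff n j * (of_nat (n + j + 12) * X j)) = (\<Sum>j\<le>Suc n. laguerre_coeff n j * (of_nat (n + j + 12) * X j))"
    by (simp add: laguerre_coeff_above)
  also have "\<dots> = laguerre_coeff (Suc n) 0 * X 0 + (\<Sum>j\<le>n. laguerre_coeff n (Suc j) * (of_nat (n + j + 13) * X (Suc j)))"
    unfolding sum.atMost_Suc_shift by (simp add: laguerre_coeff_Suc_0 add_ac)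
  finally have "(\<Sum>j\<le>n. laguerre_coeff n j * (of_nat (n + j + 12) * X j + X (Suc j))) =
      laguerre_coeff (Suc n) 0 * X 0 + (\<Sum>j\<le>n. laguerre_coeff n (Suc j) * (of_nat (n + j + 13) * X (Suc j)) + laguerre_coeff n j * X (Suc j))"
    by (simp only: distrib_left sum.distrib add.assoc)
  also have "\<dots> = (\<Sum>j\<le>Suc n. laguerre_coeff (Suc n) j * X j)"
    unfolding sum.atMost_Suc_shift laguerre_coeff_Suc by (simp add: algebra_simps)
  finally show ?thesis .
qed

lemma laguerre_coeff_sum_cancel:
  fixes e :: complex and b :: "nat \<Rightarrow> complex"
  shows "(\<Sum>r\<le>n. laguerre_coeff n r * (of_nat (r * (r + 11)) * e ^ (n - r) * b (r - 1))) =
    (\<Sum>r\<le>n. laguerre_coeff n r * (of_nat (n - r) * e ^ (n - r - 1) * b r))"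
proof (cases n)
  case (Suc m)
  \<comment> \<open>The term \<open>r = 0\<close> has the factor 0, so the truncated
    \<open>b (0 - 1)\<close> is harmless and the index can be shifted.\<close>
  have "(\<Sum>r\<le>n. laguerre_coeff n r * (of_nat (r * (r + 11)) * e ^ (n - r) * b (r - 1))) =
      (\<Sum>r\<le>m. of_nat ((r + 1) * (r + 12)) * laguerre_coeff n (Suc r) * (e ^ (n - Suc r) * b r))"
    unfolding Suc sum.atMost_Suc_shift
    by (simp add: add_ac) (intro sum.cong refl, simp only: mult_ac)
  also have "\<dots> = (\<Sum>r\<le>m. of_nat (n - r) * laguerre_coeff n r * (e ^ (n - Suc r) * b r))"
    by (intro sum.cong refl arg_cong2[where f = "(*)"] laguerre_coeff_Suc_right) (simp add: Suc)
  also have "\<dots> = (\<Sum>r\<le>n. laguerre_coeff n r * (of_nat (n - r) * e ^ (n - r - 1) * b r))"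
    unfolding Suc by (simp add: mult_ac)
  finally show ?thesis .
qed simp

text \<open>The recursion solved for the derivative, with \<open>2 pi i / 12 = pi i / 6\<close>. At
  \<open>r = 0\<close> it holds because \<open>calB 1 = 0\<close> and the factor \<open>r\<close>
  kills the term with truncated index \<open>r - 1\<close>.\<close>

lemma calB_has_field_derivative:
  assumes z: "z \<in> upper_half_plane"
  shows "(calB r has_field_derivative of_real pi * \<i> / 6 *
    (calB (Suc r) z + 2 * of_nat r * E2 z * calB r z + of_nat (r * (r + 11)) * E4 z * calB (r - 1) z)) (at z)"
proof -
  obtain F where "q_expansion (calB r) F" using calB_q_expansion by blast
  from q_expansion_has_field_derivative[OF this z]
  have "(calB r has_field_derivative deriv (calB r) z) (at z)"
    using DERIV_imp_deriv by metis
  also have "deriv (calB r) z = of_real pi * \<i> / 6 *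
    (calB (Suc r) z + 2 * of_nat r * E2 z * calB r z + of_nat (r * (r + 11)) * E4 z * calB (r - 1) z)"
  proof (cases r)
    case (Suc n)
    show ?thesis
      unfolding Suc calB.simps serre_deriv_def D_op_def by (simp add: algebra_simps)
  qed simp
  finally show ?thesis .
qed

lemma E2_has_field_derivative:
  assumes z: "z \<in> upper_half_plane"
  shows "(E2 has_field_derivative of_real pi * \<i> / 6 * ((E2 z)\<^sup>2 - E4 z)) (at z)"
proof -
  from q_expansion_has_field_derivative[OF q_expansion_E2 z]
  have "(E2 has_field_derivative deriv E2 z) (at z)"
    using DERIV_imp_deriv by metis
  also have "deriv E2 z = of_real pi * \<i> / 6 * ((E2 z)\<^sup>2 - E4 z)"
    unfolding ramanujan_E2[OF z, symmetric] by (simp add: D_op_def)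
  finally show ?thesis .
qed

text \<open>In one differentiation the term with \<open>calB r\<close> gains the factor 12 from
  \<open>Delta\<close>, \<open>n - r\<close> from the power of \<open>E2\<close> and
  \<open>2 r\<close> from \<open>calB r\<close>, in total \<open>n + r + 12\<close> times
  \<open>E2\<close>. The terms with \<open>E4\<close> cancel by
  \<open>laguerre_coeff_sum_cancel\<close>.\<close>

lemma higher_deriv_Delta:
  assumes z: "z \<in> upper_half_plane"
  shows "(deriv ^^ n) Delta z = (of_real pi * \<i> / 6) ^ n *
    (Delta z * (\<Sum>r\<le>n. laguerre_coeff n r * (E2 z ^ (n - r) * calB r z)))"
  using z
proof (induction n arbitrary: z)
  case 0
  then show ?case by (simp add: laguerre_coeff_0_0)
next
  case (Suc n)
  define \<kappa> where "\<kappa> = of_real pi * \<i> / 6"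
  define e Q b where "e = E2 z" and "Q = E4 z" and "b = (\<lambda>r. calB r z)"
  define b' where "b' = (\<lambda>r. b (Suc r) + 2 * of_nat r * e * b r + of_nat (r * (r + 11)) * Q * b (r - 1))"
  define A where "A = (\<Sum>r\<le>n. laguerre_coeff n r * (e ^ (n - r) * b r))"
  define A' where "A' = (\<Sum>r\<le>n. laguerre_coeff n r * (of_nat (n - r) * e ^ (n - r - 1) * (e\<^sup>2 - Q) * b r + e ^ (n - r) * b' r))"
  have "((\<lambda>z. \<kappa> ^ n * (Delta z * (\<Sum>r\<le>n. laguerre_coeff n r * (E2 z ^ (n - r) * calB r z)))) has_field_derivative
      \<kappa> ^ n * (12 * \<kappa> * (e * Delta z) * A + Delta z * (\<kappa> * A'))) (at z)"
  proof -
    have trm: "((\<lambda>z. E2 z ^ (n - r) * calB r z) has_field_derivative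
        \<kappa> * (of_nat (n - r) * e ^ (n - r - 1) * (e\<^sup>2 - Q) * b r + e ^ (n - r) * b' r)) (at z)" for r
    proof -
      have "(E2 has_field_derivative \<kappa> * (e\<^sup>2 - Q)) (at z)"
        using E2_has_field_derivative[OF Suc.prems] by (simp only: \<kappa>_def e_def Q_def)
      moreover have "(calB r has_field_derivative \<kappa> * b' r) (at z)"
        using calB_has_field_derivative[OF Suc.prems, of r] by (simp only: \<kappa>_def e_def Q_def b_def b'_def)
      ultimately show ?thesis
        using DERIV_mult'[OF DERIV_power[of E2 _ z UNIV "n - r"], of _ "calB r"]
        by (rule_tac DERIV_cong) (auto simp: e_def b_def algebra_simps)
    qed
    have "((\<lambda>z. \<Sum>r\<le>n. laguerre_coeff n r * (E2 z ^ (n - r) * calB r z)) has_field_derivative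
        (\<Sum>r\<le>n. laguerre_coeff n r * (\<kappa> * (of_nat (n - r) * e ^ (n - r - 1) * (e\<^sup>2 - Q) * b r + e ^ (n - r) * b' r)))) (at z)"
      by (intro DERIV_sum DERIV_cmult trm)
    also have "(\<Sum>r\<le>n. laguerre_coeff n r * (\<kappa> * (of_nat (n - r) * e ^ (n - r - 1) * (e\<^sup>2 - Q) * b r + e ^ (n - r) * b' r))) = \<kappa> * A'"
      unfolding A'_def sum_distrib_left by (intro sum.cong refl) (simp only: mult_ac)
    finally show ?thesis
      by (intro DERIV_cmult DERIV_cong[OF DERIV_mult'[OF Delta_has_field_derivative[OF Suc.prems]]])
         (auto simp: \<kappa>_def e_def A_def b_def)
  qed
  then have "((deriv ^^ n) Delta has_field_derivative
      \<kappa> ^ n * (12 * \<kappa> * (e * Delta z) * A + Delta z * (\<kappa> * A'))) (at z)"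
    by (rule has_field_derivative_transform_within_open[OF _ open_upper_half_plane Suc.prems])
       (simp add: Suc.IH \<kappa>_def)
  then have "(deriv ^^ Suc n) Delta z = \<kappa> ^ n * (12 * \<kappa> * (e * Delta z) * A + Delta z * (\<kappa> * A'))"
    by (simp add: DERIV_imp_deriv)
  also have "\<dots> = \<kappa> ^ Suc n * (Delta z * (12 * e * A + A'))"
    by (simp add: algebra_simps)
  also have "12 * e * A + A' = (\<Sum>r\<le>Suc n. laguerre_coeff (Suc n) r * (e ^ (Suc n - r) * b r))"
  proof -
    have t: "12 * e * (laguerre_coeff n r * (e ^ (n - r) * b r)) +
        laguerre_coeff n r * (of_nat (n - r) * e ^ (n - r - 1) * (e\<^sup>2 - Q) * b r + e ^ (n - r) * b' r) =
        laguerre_coeff n r * (of_nat (n + r + 12) * (e ^ (Suc n - r) * b r) + e ^ (Suc n - Suc r) * b (Suc r)) +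
        Q * (laguerre_coeff n r * (of_nat (r * (r + 11)) * e ^ (n - r) * b (r - 1))) -
        Q * (laguerre_coeff n r * (of_nat (n - r) * e ^ (n - r - 1) * b r))" if "r \<le> n" for r
    \<comment> \<open>At \<open>r = n\<close> the truncated exponent \<open>n - r - 1\<close> stands
      beside the factor 0; otherwise the subtraction is genuine.\<close>
    proof (cases "r = n")
      case True
      then show ?thesis by (simp add: b'_def algebra_simps)
    next
      case False
      with that obtain k where k: "n = Suc (r + k)" using less_imp_Suc_add[of r n] by auto
      then have "n - r = Suc k" "Suc n - r = Suc (Suc k)" by simp_all
      then show ?thesis
        by (simp add: b'_def k algebra_simps power2_eq_square)
    qed
    have "12 * e * A + A' = (\<Sum>r\<le>n. laguerre_coeff n r * (of_nat (n + r + 12) * (e ^ (Suc n - r) * b r) + e ^ (Suc n - Suc r) * b (Suc r))) +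
        Q * (\<Sum>r\<le>n. laguerre_coeff n r * (of_nat (r * (r + 11)) * e ^ (n - r) * b (r - 1))) -
        Q * (\<Sum>r\<le>n. laguerre_coeff n r * (of_nat (n - r) * e ^ (n - r - 1) * b r))"
      unfolding A_def A'_def sum_distrib_left sum.distrib[symmetric] sum_subtractf[symmetric]
      by (intro sum.cong refl) (simp only: t atMost_iff)
    also have "\<dots> = (\<Sum>r\<le>n. laguerre_coeff n r * (of_nat (n + r + 12) * (e ^ (Suc n - r) * b r) + e ^ (Suc n - Suc r) * b (Suc r)))"
      unfolding laguerre_coeff_sum_cancel by simp
    also have "\<dots> = (\<Sum>r\<le>Suc n. laguerre_coeff (Suc n) r * (e ^ (Suc n - r) * b r))"
      by (rule laguerre_coeff_sum_Suc)
    finally show ?thesis .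
  qed
  finally show ?case by (simp only: \<kappa>_def e_def b_def)
qed

subsection \<open>Expansion about a point of the upper half-plane\<close>

text \<open>The numerator times the conjugate denominator has imaginary part
  \<open>Im z * (1 - |w|^2)\<close>.\<close>

lemma cayley_in_upper_half_plane:
  assumes z: "z \<in> upper_half_plane" and w: "norm w < 1"
  shows "(z - cnj z * w) / (1 - w) \<in> upper_half_plane"
proof -
  have "1 - w \<noteq> 0" using w by auto
  then have pos: "0 < (cmod (1 - w))\<^sup>2" by simp
  have "Im ((z - cnj z * w) * cnj (1 - w)) = Im z * (1 - (cmod w)\<^sup>2)"
    unfolding cmod_power2 by (simp add: power2_eq_square algebra_simps)
  moreover have "(cmod w)\<^sup>2 < 1" using w by (simp add: power_less_one_iff)
  ultimately have "0 < Im ((z - cnj z * w) * cnj (1 - w))"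
    using z by (simp add: upper_half_plane_def)
  moreover have "(z - cnj z * w) / (1 - w) = ((z - cnj z * w) * cnj (1 - w)) / of_real ((cmod (1 - w))\<^sup>2)"
    by (subst complex_div_cnj) simp
  then have "Im ((z - cnj z * w) / (1 - w)) = Im ((z - cnj z * w) * cnj (1 - w)) / (cmod (1 - w))\<^sup>2"
    by (simp only: Im_divide_of_real)
  ultimately show ?thesis
    using pos by (simp add: upper_half_plane_def)
qed

text \<open>With \<open>s = 1 / (1 - w)\<close> and \<open>v\<close> the transformed point,
  \<open>s' = s^2\<close> and \<open>v' = (z - cnj z) s^2\<close>, so each derivative has the shape
  required by \<open>laguerre_coeff_sum_Suc\<close>.\<close>

lemma higher_deriv_cayley:
  assumes f: "f holomorphic_on upper_half_plane" and z: "z \<in> upper_half_plane" and w: "norm w < 1"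
  shows "(deriv ^^ n) (\<lambda>w. (1 / (1 - w)) ^ 12 * f ((z - cnj z * w) / (1 - w))) w =
    (\<Sum>j\<le>n. laguerre_coeff n j * ((z - cnj z) ^ j * (1 / (1 - w)) ^ (n + j + 12) *
      (deriv ^^ j) f ((z - cnj z * w) / (1 - w))))"
  using w
proof (induction n arbitrary: w)
  case 0
  then show ?case by (simp add: laguerre_coeff_0_0)
next
  case (Suc n)
  define Y where "Y = z - cnj z"
  define s where "s = 1 / (1 - w)"
  define v where "v = (z - cnj z * w) / (1 - w)"
  have w1: "1 - w \<noteq> 0" using Suc.prems by auto
  have v: "v \<in> upper_half_plane"
    unfolding v_def by (rule cayley_in_upper_half_plane[OF z Suc.prems])
  have ds: "((\<lambda>w. 1 / (1 - w)) has_field_derivative s\<^sup>2) (at w)"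
    using w1 by (auto intro!: derivative_eq_intros simp: s_def power2_eq_square)
  have dv: "((\<lambda>w. (z - cnj z * w) / (1 - w)) has_field_derivative Y * s\<^sup>2) (at w)"
    using w1 by (auto intro!: derivative_eq_intros simp: s_def Y_def power2_eq_square divide_simps)
      (simp add: algebra_simps)
  have df: "((deriv ^^ j) f has_field_derivative (deriv ^^ Suc j) f v) (at v)" for j
    using holomorphic_derivI[OF holomorphic_higher_deriv[OF f open_upper_half_plane, of j]
        open_upper_half_plane v] by simp
  define X where "X = (\<lambda>j. Y ^ j * s ^ (Suc n + j + 12) * (deriv ^^ j) f v)"
  have "((\<lambda>w. Y ^ j * (1 / (1 - w)) ^ (n + j + 12) * (deriv ^^ j) f ((z - cnj z * w) / (1 - w)))
      has_field_derivative (of_nat (n + j + 12) * X j + X (Suc j))) (at w)" for j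
  proof -
    have 1: "((\<lambda>w. (deriv ^^ j) f ((z - cnj z * w) / (1 - w))) has_field_derivative
        (deriv ^^ Suc j) f v * (Y * s\<^sup>2)) (at w)"
      using df[of j] unfolding v_def by (rule DERIV_chain2) (rule dv)
    define N where "N = n + j + 11"
    have N: "n + j + 12 = Suc N" "Suc n + j + 12 = Suc (Suc N)" "Suc n + Suc j + 12 = Suc (Suc (Suc N))"
      by (simp_all add: N_def)
    have "((\<lambda>w. Y ^ j * (1 / (1 - w)) ^ Suc N * (deriv ^^ j) f ((z - cnj z * w) / (1 - w)))
        has_field_derivative (Y ^ j * s ^ Suc N * ((deriv ^^ Suc j) f v * (Y * s\<^sup>2)) +
          Y ^ j * (of_nat (Suc N) * (s\<^sup>2 * s ^ N)) * (deriv ^^ j) f v)) (at w)"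
      using DERIV_mult'[OF DERIV_cmult[OF DERIV_power[OF ds, of "Suc N"], of "Y ^ j"] 1]
      unfolding s_def v_def diff_Suc_Suc diff_zero .
    then show ?thesis
      unfolding N X_def by (rule DERIV_cong) (simp add: algebra_simps power2_eq_square)
  qed
  then have "((\<lambda>w. \<Sum>j\<le>n. laguerre_coeff n j * (Y ^ j * (1 / (1 - w)) ^ (n + j + 12) *
      (deriv ^^ j) f ((z - cnj z * w) / (1 - w))))
      has_field_derivative (\<Sum>j\<le>n. laguerre_coeff n j * (of_nat (n + j + 12) * X j + X (Suc j)))) (at w)"
    by (intro DERIV_sum DERIV_cmult)
  then have "((deriv ^^ n) (\<lambda>w. (1 / (1 - w)) ^ 12 * f ((z - cnj z * w) / (1 - w)))
      has_field_derivative (\<Sum>j\<le>n. laguerre_coeff n j * (of_nat (n + j + 12) * X j + X (Suc j)))) (at w)"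
    by (rule has_field_derivative_transform_within_open[where S = "ball 0 1"])
       (use Suc.prems in \<open>auto simp: Suc.IH Y_def\<close>)
  then have "(deriv ^^ Suc n) (\<lambda>w. (1 / (1 - w)) ^ 12 * f ((z - cnj z * w) / (1 - w))) w =
      (\<Sum>j\<le>n. laguerre_coeff n j * (of_nat (n + j + 12) * X j + X (Suc j)))"
    by (simp add: DERIV_imp_deriv)
  then show ?case
    unfolding laguerre_coeff_sum_Suc by (simp only: X_def Y_def s_def v_def)
qed

text \<open>With \<open>t = z - cnj z\<close> the determinant is \<open>1 / t\<close>, and the
  denominator \<open>(1 - w) / t\<close> to the power -12 supplies \<open>t^12\<close>; together
  they leave \<open>t^6\<close>.\<close>

lemma slash12_sigma_mat:
  assumes z: "z \<in> upper_half_plane"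
  shows "slash12 f (sigma_mat z) w =
    (z - cnj z) ^ 6 * ((1 / (1 - w)) ^ 12 * f ((z - cnj z * w) / (1 - w)))"
proof -
  define t where "t = 2 * \<i> * of_real (Im z)"
  have t: "t \<noteq> 0" using z by (simp add: t_def upper_half_plane_def)
  have t_eq: "z - cnj z = t" by (simp add: t_def complex_eq_iff)
  have M: "sigma_mat z $ 1 $ 1 = - cnj z / t" "sigma_mat z $ 1 $ 2 = z / t"
    "sigma_mat z $ 2 $ 1 = - 1 / t" "sigma_mat z $ 2 $ 2 = 1 / t"
    by (simp_all add: sigma_mat_def map_matrix_def t_def)
  have det: "det (sigma_mat z) = 1 / t"
  proof -
    have "det (sigma_mat z) = (z - cnj z) / (t * t)"
      unfolding det_2 M by (simp add: diff_divide_distrib)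
    then show ?thesis using t by (simp add: t_eq)
  qed
  have den: "- 1 / t * w + 1 / t = (1 - w) / t"
    by (simp add: diff_divide_distrib)
  have num: "- cnj z / t * w + z / t = (z - cnj z * w) / t"
    by (simp add: diff_divide_distrib)
  have "((1 - w) / t) powi (- 12) = (t / (1 - w)) ^ 12"
    by (simp add: power_int_minus power_divide divide_inverse power_mult_distrib power_inverse)
  moreover have "((z - cnj z * w) / t) / ((1 - w) / t) = (z - cnj z * w) / (1 - w)"
    using t by simp
  moreover have "(1 / t) ^ 6 * x * (t / (1 - w)) ^ 12 = t ^ 6 * ((1 / (1 - w)) ^ 12 * x)" for x
  proof -
    have eq: "t ^ 12 = t ^ 6 * t ^ 6" by (simp flip: power_add)
    have "1 / T * x * (T * T / u) = T * (1 / u * x)" if "T \<noteq> 0" for T u :: complex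
      using that by simp
    from this[of "t ^ 6" "(1 - w) ^ 12"] t show ?thesis
      by (simp only: power_divide power_one eq power_eq_0_iff) simp
  qed
  ultimately show ?thesis
    unfolding slash12_def M det den num t_eq by simp
qed

text \<open>The description is met by the power series on the disc, and any other candidate has the
  same derivatives at 0, hence the same coefficients.\<close>

lemma taylor_coeff12_eq:
  assumes f: "f holomorphic_on upper_half_plane" and z: "z \<in> upper_half_plane"
  shows "taylor_coeff12 z f n = (z - cnj z) ^ 6 *
    (\<Sum>j\<le>n. laguerre_coeff n j * ((z - cnj z) ^ j * (deriv ^^ j) f z)) / fact n"
proof -
  define g where "g = (\<lambda>w. (z - cnj z) ^ 6 * ((1 / (1 - w)) ^ 12 * f ((z - cnj z * w) / (1 - w))))"
  define c where "c = (\<lambda>n. (deriv ^^ n) g 0 / fact n)"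
  have "(\<lambda>w. (z - cnj z * w) / (1 - w)) holomorphic_on ball 0 1"
    by (intro holomorphic_intros) auto
  moreover have "(\<lambda>w. (z - cnj z * w) / (1 - w)) ` ball 0 1 \<subseteq> upper_half_plane"
    using cayley_in_upper_half_plane[OF z] by auto
  ultimately have h: "(\<lambda>w. f ((z - cnj z * w) / (1 - w))) holomorphic_on ball 0 1"
    using holomorphic_on_compose_gen[OF _ f] by (simp add: o_def)
  then have h': "(\<lambda>w. (1 / (1 - w)) ^ 12 * f ((z - cnj z * w) / (1 - w))) holomorphic_on ball 0 1"
    by (intro holomorphic_on_mult[OF _ h] holomorphic_intros) auto
  then have g: "g holomorphic_on ball 0 1"
    unfolding g_def by (intro holomorphic_on_mult[OF holomorphic_on_const])
  have "taylor_coeff12 z f = c"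
    unfolding taylor_coeff12_def
  proof (rule the_equality)
    show "\<forall>w. norm w < 1 \<longrightarrow> (\<lambda>n. c n * w ^ n) sums slash12 f (sigma_mat z) w"
      using holomorphic_power_series[OF g] slash12_sigma_mat[OF z]
      by (auto simp: c_def g_def)
  next
    fix c' assume c': "\<forall>w. norm w < 1 \<longrightarrow> (\<lambda>n. c' n * w ^ n) sums slash12 f (sigma_mat z) w"
    then have s: "(\<lambda>n. c' n * w ^ n) sums g w" if "norm w < 1" for w
      using c' slash12_sigma_mat[OF z, of f] that unfolding g_def by metis
    have "1 \<le> fps_conv_radius (Abs_fps c')"
      unfolding fps_conv_radius_def
    proof (rule conv_radius_geI_ex')
      fix r :: real assume "0 < r" "ereal r < 1"
      then show "summable (\<lambda>n. fps_nth (Abs_fps c') n * of_real r ^ n)"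
        using s[of "of_real r"] by (simp add: sums_iff)
    qed
    then have pos: "0 < fps_conv_radius (Abs_fps c')"
      by (rule order_less_le_trans[rotated]) simp
    have "eval_fps (Abs_fps c') w = g w" if "norm w < 1" for w
      using s[OF that] by (simp add: eval_fps_def sums_iff)
    then have "\<forall>\<^sub>F w in nhds 0. eval_fps (Abs_fps c') w = g w"
      using eventually_nhds_in_open[of "ball 0 1" "0 :: complex"]
      by (auto elim!: eventually_mono)
    then have "(deriv ^^ n) (eval_fps (Abs_fps c')) 0 = (deriv ^^ n) g 0" for n
      by (rule higher_deriv_cong_ev) simp
    then show "c' = c"
      using fps_nth_conv_deriv[OF pos] by (auto simp: c_def)
  qed
  moreover have "(deriv ^^ n) g 0 = (z - cnj z) ^ 6 *
      (deriv ^^ n) (\<lambda>w. (1 / (1 - w)) ^ 12 * f ((z - cnj z * w) / (1 - w))) 0"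
    unfolding g_def by (rule higher_deriv_cmult[OF h']) auto
  ultimately show ?thesis
    using higher_deriv_cayley[OF f z, of 0 n] by (simp add: c_def)
qed

text \<open>The factorials of \<open>r + k\<close> and \<open>r + k + 11\<close> cancel, so
  composing two such expansions leaves a plain binomial coefficient.\<close>

lemma laguerre_coeff_mult:
  assumes "r + k \<le> m"
  shows "laguerre_coeff m (r + k) * laguerre_coeff (r + k) r = laguerre_coeff m r * of_nat ((m - r) choose k)"
proof -
  define A B C D E F where "A = (fact r :: complex)" and "B = (fact (r + 11) :: complex)"
    and "C = (fact (r + k) :: complex)" and "D = (fact (r + k + 11) :: complex)"
    and "E = (fact k :: complex)" and "F = (fact (m - r - k) :: complex)"
  define G P where "G = (fact (m - r) :: complex)" and "P = (fact m * fact (m + 11) :: complex)"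
  have nz: "A \<noteq> 0" "B \<noteq> 0" "C \<noteq> 0" "D \<noteq> 0" "E \<noteq> 0" "F \<noteq> 0" "G \<noteq> 0"
    by (simp_all add: A_def B_def C_def D_def E_def F_def G_def)
  have "laguerre_coeff m (r + k) = P / (C * D * F)"
    using assms by (simp add: laguerre_coeff_eq P_def C_def D_def F_def)
  moreover have "laguerre_coeff (r + k) r = C * D / (A * B * E)"
    by (simp add: laguerre_coeff_eq A_def B_def C_def D_def E_def)
  moreover have "laguerre_coeff m r = P / (A * B * G)"
    using assms by (simp add: laguerre_coeff_eq P_def A_def B_def G_def)
  moreover have "of_nat ((m - r) choose k) = G / (E * F)"
    using assms by (simp add: binomial_fact E_def F_def G_def)
  ultimately show ?thesis
    using nz by simp
qed

text \<open>Put \<open>j = r + k\<close> and sum over \<open>k\<close> first: this is the binomial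
  expansion of \<open>(u * e + 1) ^ (m - r)\<close>.\<close>

lemma laguerre_coeff_double_sum:
  fixes u e :: complex and b :: "nat \<Rightarrow> complex"
  shows "(\<Sum>j\<le>m. laguerre_coeff m j * (u ^ j * (\<Sum>r\<le>j. laguerre_coeff j r * (e ^ (j - r) * b r)))) =
    (\<Sum>r\<le>m. laguerre_coeff m r * (u ^ r * (u * e + 1) ^ (m - r) * b r))"
proof -
  have "(\<Sum>j\<le>m. laguerre_coeff m j * (u ^ j * (\<Sum>r\<le>j. laguerre_coeff j r * (e ^ (j - r) * b r)))) =
      (\<Sum>(j, r)\<in>Sigma {..m} (\<lambda>j. {..j}). laguerre_coeff m j * (u ^ j * (laguerre_coeff j r * (e ^ (j - r) * b r))))"
    by (simp add: sum.Sigma sum_distrib_left)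
  also have "\<dots> = (\<Sum>(r, k)\<in>Sigma {..m} (\<lambda>r. {..m - r}).
      laguerre_coeff m (r + k) * (u ^ (r + k) * (laguerre_coeff (r + k) r * (e ^ k * b r))))"
    by (rule sum.reindex_bij_witness[where i = "\<lambda>(r, k). (r + k, r)" and j = "\<lambda>(j, r). (r, j - r)"]) auto
  also have "\<dots> = (\<Sum>r\<le>m. \<Sum>k\<le>m - r. laguerre_coeff m (r + k) * (u ^ (r + k) * (laguerre_coeff (r + k) r * (e ^ k * b r))))"
    by (simp add: sum.Sigma)
  also have "\<dots> = (\<Sum>r\<le>m. laguerre_coeff m r * (u ^ r * (u * e + 1) ^ (m - r) * b r))"
  proof (rule sum.cong[OF refl])
    fix r assume r: "r \<in> {..m}"
    have "(\<Sum>k\<le>m - r. laguerre_coeff m (r + k) * (u ^ (r + k) * (laguerre_coeff (r + k) r * (e ^ k * b r)))) =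
        (\<Sum>k\<le>m - r. laguerre_coeff m r * (u ^ r * b r) * (of_nat ((m - r) choose k) * (u * e) ^ k * 1 ^ (m - r - k)))"
    proof (rule sum.cong[OF refl])
      fix k assume "k \<in> {..m - r}"
      then have "r + k \<le> m" using r by auto
      from laguerre_coeff_mult[OF this]
      have "laguerre_coeff m (r + k) * laguerre_coeff (r + k) r * (u ^ (r + k) * (e ^ k * b r)) =
          laguerre_coeff m r * of_nat ((m - r) choose k) * (u ^ (r + k) * (e ^ k * b r))"
        by simp
      then show "laguerre_coeff m (r + k) * (u ^ (r + k) * (laguerre_coeff (r + k) r * (e ^ k * b r))) =
          laguerre_coeff m r * (u ^ r * b r) * (of_nat ((m - r) choose k) * (u * e) ^ k * 1 ^ (m - r - k))"
        by (simp add: power_add power_mult_distrib mult_ac)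
    qed
    also have "\<dots> = laguerre_coeff m r * (u ^ r * b r) * (u * e + 1) ^ (m - r)"
      unfolding binomial_ring sum_distrib_left ..
    finally show "(\<Sum>k\<le>m - r. laguerre_coeff m (r + k) * (u ^ (r + k) * (laguerre_coeff (r + k) r * (e ^ k * b r)))) =
        laguerre_coeff m r * (u ^ r * (u * e + 1) ^ (m - r) * b r)"
      by (simp only: mult_ac)
  qed
  finally show ?thesis .
qed

subsection \<open>Modularity\<close>

text \<open>Periodicity comes with the expansions, so among the generators of the modular group only
  this one has to be tracked.\<close>

definition inversion_covariant :: "nat \<Rightarrow> (complex \<Rightarrow> complex) \<Rightarrow> bool" where
  "inversion_covariant k f \<longleftrightarrow> (\<forall>z\<in>upper_half_plane. f (- 1 / z) = z ^ k * f z)"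

lemma inversion_has_field_derivative:
  assumes f: "(f has_field_derivative f') (at (- 1 / z))" and z: "z \<noteq> 0"
  shows "((\<lambda>z. f (- 1 / z)) has_field_derivative f' * (1 / z\<^sup>2)) (at z)"
proof -
  have "((\<lambda>z. - 1 / z) has_field_derivative 1 / z\<^sup>2) (at z)"
    using z by (auto intro!: derivative_eq_intros simp: power2_eq_square)
  with f show ?thesis by (rule DERIV_chain2)
qed

text \<open>Differentiating \<open>z ^ k\<close> leaves the extra term
  \<open>k z^(k+1) f / (2 pi i)\<close>; the correction \<open>6 z / (pi i)\<close> of
  \<open>E2\<close>, times \<open>k / 12\<close>, removes exactly this.\<close>

lemma serre_deriv_inversion_covariant:
  assumes f: "f holomorphic_on upper_half_plane" and inv: "inversion_covariant k f"
  shows "inversion_covariant (k + 2) (serre_deriv k f)"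
  unfolding inversion_covariant_def
proof
  fix z assume z: "z \<in> upper_half_plane"
  note y = upper_half_plane_minus_inverse[OF z]
  have d: "(f has_field_derivative deriv f w) (at w)" if "w \<in> upper_half_plane" for w
    using holomorphic_derivI[OF f open_upper_half_plane that] .
  have "((\<lambda>z. f (- 1 / z)) has_field_derivative deriv f (- 1 / z) * (1 / z\<^sup>2)) (at z)"
    by (rule inversion_has_field_derivative[OF d[OF y(1)] y(2)])
  moreover have "((\<lambda>z. z ^ k * f z) has_field_derivative z ^ k * deriv f z + of_nat k * z ^ (k - 1) * f z) (at z)"
    by (rule DERIV_cong[OF DERIV_mult'[OF DERIV_power[OF DERIV_ident] d[OF z]]]) simp
  then have "((\<lambda>z. f (- 1 / z)) has_field_derivative z ^ k * deriv f z + of_nat k * z ^ (k - 1) * f z) (at z)"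
    by (rule has_field_derivative_transform_within_open[OF _ open_upper_half_plane z])
       (use inv in \<open>simp add: inversion_covariant_def\<close>)
  ultimately have "deriv f (- 1 / z) * (1 / z\<^sup>2) = z ^ k * deriv f z + of_nat k * z ^ (k - 1) * f z"
    by (rule DERIV_unique)
  then have "deriv f (- 1 / z) = z\<^sup>2 * (z ^ k * deriv f z + of_nat k * z ^ (k - 1) * f z)"
    using y(2) by (simp add: divide_eq_eq mult.commute)
  also have "\<dots> = z\<^sup>2 * (z ^ k * deriv f z) + z\<^sup>2 * (of_nat k * z ^ (k - 1) * f z)"
    by (rule distrib_left)
  \<comment> \<open>At \<open>k = 0\<close> the truncated exponent \<open>k - 1\<close> does no
    harm, as both sides carry the factor \<open>of_nat k\<close>.\<close>
  also have "z\<^sup>2 * (of_nat k * z ^ (k - 1) * f z) = of_nat k * (z * z ^ k) * f z"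
    by (cases k) (simp_all add: power2_eq_square)
  finally have "deriv f (- 1 / z) = z ^ (k + 2) * deriv f z + of_nat k * (z * z ^ k) * f z"
    by (simp add: power_add power2_eq_square mult_ac)
  then show "serre_deriv k f (- 1 / z) = z ^ (k + 2) * serre_deriv k f z"
    using inv z unfolding serre_deriv_def D_op_def E2_inversion[OF z] inversion_covariant_def
    by (simp add: field_simps power_add power2_eq_square)
qed

lemma inversion_covariant_mult:
  assumes "inversion_covariant k f" "inversion_covariant l g"
  shows "inversion_covariant (k + l) (\<lambda>z. f z * g z)"
  using assms by (simp add: inversion_covariant_def power_add mult_ac)

lemma inversion_covariant_diff:
  assumes "inversion_covariant k f" "inversion_covariant k g"
  shows "inversion_covariant k (\<lambda>z. f z - g z)"
  using assms by (simp add: inversion_covariant_def right_diff_distrib)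

lemma inversion_covariant_cmult:
  assumes "inversion_covariant k f"
  shows "inversion_covariant k (\<lambda>z. c * f z)"
  using assms by (simp add: inversion_covariant_def mult_ac)

text \<open>In \<open>E4 = E2^2 - 12 D E2\<close> the terms \<open>12 z^3 E2 / P\<close> and
  \<open>36 z^2 / P^2\<close> arise once from the square and once from the derivative, and
  cancel.\<close>

lemma E4_inversion_covariant: "inversion_covariant 4 E4"
  unfolding inversion_covariant_def
proof
  fix z assume z: "z \<in> upper_half_plane"
  note y = upper_half_plane_minus_inverse[OF z]
  have d: "(E2 has_field_derivative deriv E2 w) (at w)" if "w \<in> upper_half_plane" for w
    using holomorphic_derivI[OF q_expansion_holomorphic[OF q_expansion_E2] open_upper_half_plane that] .
  define P where "P = complex_of_real pi * \<i>"
  have P: "P \<noteq> 0" by (simp add: P_def)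
  have "((\<lambda>z. E2 (- 1 / z)) has_field_derivative deriv E2 (- 1 / z) * (1 / z\<^sup>2)) (at z)"
    by (rule inversion_has_field_derivative[OF d[OF y(1)] y(2)])
  moreover have "((\<lambda>z. z\<^sup>2 * E2 z + 6 * z / P) has_field_derivative
      z\<^sup>2 * deriv E2 z + 2 * z * E2 z + 6 / P) (at z)"
    using d[OF z] P by (auto intro!: derivative_eq_intros)
  then have "((\<lambda>z. E2 (- 1 / z)) has_field_derivative z\<^sup>2 * deriv E2 z + 2 * z * E2 z + 6 / P) (at z)"
    by (rule has_field_derivative_transform_within_open[OF _ open_upper_half_plane z])
       (simp only: E2_inversion P_def)
  ultimately have "deriv E2 (- 1 / z) * (1 / z\<^sup>2) = z\<^sup>2 * deriv E2 z + 2 * z * E2 z + 6 / P"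
    by (rule DERIV_unique)
  then have D: "deriv E2 (- 1 / z) = z\<^sup>2 * (z\<^sup>2 * deriv E2 z + 2 * z * E2 z + 6 / P)"
    using y(2) by (simp add: divide_eq_eq mult.commute)
  have E4: "E4 w = (E2 w)\<^sup>2 - 6 / P * deriv E2 w" if "w \<in> upper_half_plane" for w
    using ramanujan_E2[OF that] by (simp add: D_op_def P_def algebra_simps)
  show "E4 (- 1 / z) = z ^ 4 * E4 z"
    unfolding E4[OF z] E4[OF y(1)] D E2_inversion[OF z] P_def[symmetric] using P
    by (simp add: field_simps power2_eq_square power4_eq_xxxx)
qed

lemma calB_inversion_covariant: "inversion_covariant (2 * r) (calB r)"
proof (induction r rule: calB.induct)
  case (3 n)
  obtain F where "q_expansion (calB (Suc n)) F" using calB_q_expansion by blast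
  then have A: "inversion_covariant (2 * Suc (Suc n)) (serre_deriv (2 * (n + 1)) (calB (Suc n)))"
    using serre_deriv_inversion_covariant[OF q_expansion_holomorphic "3.IH"(1)] by simp
  have "inversion_covariant (4 + 2 * n) (\<lambda>z. of_nat ((n + 1) * (n + 12)) * (E4 z * calB n z))"
    by (intro inversion_covariant_cmult inversion_covariant_mult E4_inversion_covariant "3.IH"(2))
  moreover have "4 + 2 * n = 2 * Suc (Suc n)" by simp
  ultimately have B: "inversion_covariant (2 * Suc (Suc n)) (\<lambda>z. of_nat ((n + 1) * (n + 12)) * (E4 z * calB n z))"
    by (simp only:)
  from inversion_covariant_diff[OF inversion_covariant_cmult[OF A, of 12] B]
  show ?case by (simp only: calB.simps mult.assoc)
qed (simp_all add: inversion_covariant_def)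

lemma periodic_int:
  fixes f :: "complex \<Rightarrow> complex" and b :: int
  assumes per: "\<And>z. z \<in> upper_half_plane \<Longrightarrow> f (z + 1) = f z" and z: "z \<in> upper_half_plane"
  shows "f (z + of_int b) = f z"
proof (induction b rule: int_induct[of _ 0])
  case (step1 i)
  have "z + of_int i \<in> upper_half_plane" using z by (simp add: upper_half_plane_def)
  from per[OF this] step1 show ?case by (simp add: add_ac)
next
  case (step2 i)
  have "z + of_int (i - 1) \<in> upper_half_plane" using z by (simp add: upper_half_plane_def)
  from per[OF this] step2 show ?case by simp
qed simp

text \<open>Euclid's algorithm on the lower row: translations reduce \<open>d\<close> modulo \<open>c\<close>, inversion swaps them.\<close>

lemma modular_from_generators:
  fixes a b c d :: int
  assumes per: "\<And>z. z \<in> upper_half_plane \<Longrightarrow> f (z + 1) = f z"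
    and inv: "inversion_covariant (2 * r) f"
    and det: "a * d - b * c = 1" and z: "z \<in> upper_half_plane"
  shows "f ((of_int a * z + of_int b) / (of_int c * z + of_int d)) = (of_int c * z + of_int d) ^ (2 * r) * f z"
  using det z
proof (induction "nat \<bar>c\<bar>" arbitrary: a b c d z rule: less_induct)
  case less
  show ?case
  proof (cases "c = 0")
    case True
    then have "a * d = 1" using less.prems by simp
    then consider "a = 1" "d = 1" | "a = - 1" "d = - 1"
      by (auto simp: zmult_eq_1_iff)
    then show ?thesis
    proof cases
      case 1
      then show ?thesis using True periodic_int[of f, OF per less.prems(2)] by simp
    next
      case 2
      \<comment> \<open>The even exponent absorbs the sign of \<open>d = - 1\<close>.\<close>
      then show ?thesis using True periodic_int[of f, OF per less.prems(2), of "- b"] by (simp add: power_mult)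
    qed
  next
    case False
    define q where "q = d div c"
    define e where "e = d - q * c"
    define b' where "b' = b - q * a"
    have e: "e = d mod c" by (simp add: e_def q_def minus_div_mult_eq_mod)
    define v where "v = z + of_int q"
    have v: "v \<in> upper_half_plane" using less.prems(2) by (simp add: v_def upper_half_plane_def)
    note y = upper_half_plane_minus_inverse[OF v]
    have det': "a * e - b' * c = 1"
      using less.prems(1) by (simp add: e_def b'_def algebra_simps)
    have "nat \<bar>e\<bar> < nat \<bar>c\<bar>"
      using False abs_mod_less[of c d] unfolding e by simp
    \<comment> \<open>The induction hypothesis is applied at \<open>- 1 / v\<close> to the matrix
      with rows \<open>b', - a\<close> and \<open>e, - c\<close>, whose lower left entry is the
      remainder \<open>e\<close>.\<close>
    moreover have "b' * (- c) - (- a) * e = 1" using det' by (simp add: algebra_simps)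
    ultimately have IH: "f ((of_int b' * (- 1 / v) + of_int (- a)) / (of_int e * (- 1 / v) + of_int (- c))) =
        (of_int e * (- 1 / v) + of_int (- c)) ^ (2 * r) * f (- 1 / v)"
      by (rule less.hyps[OF _ _ y(1)])
    have den: "of_int e * (- 1 / v) + of_int (- c) = - ((of_int c * v + of_int e) / v)"
      using y(2) by (simp add: field_simps)
    have num: "of_int b' * (- 1 / v) + of_int (- a) = - ((of_int a * v + of_int b') / v)"
      using y(2) by (simp add: field_simps)
    have "of_int a * v + of_int b' = of_int a * z + of_int b"
      "of_int c * v + of_int e = of_int c * z + of_int d"
      by (simp_all add: v_def b'_def e_def algebra_simps)
    moreover have "f ((of_int a * v + of_int b') / (of_int c * v + of_int e)) =
        ((of_int c * v + of_int e) / v) ^ (2 * r) * f (- 1 / v)"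
    proof -
      have "- (x / v) / - (w / v) = x / w" for x w using y(2) by simp
      moreover have "(- x) ^ (2 * r) = x ^ (2 * r)" for x :: complex by (simp add: power_mult)
      ultimately show ?thesis using IH unfolding den num by (simp only:)
    qed
    moreover have "f (- 1 / v) = v ^ (2 * r) * f v"
      using inv v by (simp add: inversion_covariant_def)
    moreover have "f v = f z"
      unfolding v_def by (rule periodic_int[of f, OF per less.prems(2)])
    ultimately show ?thesis
      using y(2) by (simp add: power_divide)
  qed
qed

theorem calB_modular_form: "calB r \<in> modular_forms (2 * r)"
proof -
  obtain F where F: "q_expansion (calB r) F" using calB_q_expansion by blast
  have "(\<lambda>n. fps_nth F n * nome z ^ n) sums calB r z" if "z \<in> upper_half_plane" for z
    using sums_eval_fps[OF q_expansion_nome_in_radius[OF F that]] F that by (simp add: q_expansion_def)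
  then show ?thesis
    unfolding modular_forms_def
    using q_expansion_holomorphic[OF F] q_expansion_periodic[OF F] calB_inversion_covariant[of r]
    by (auto intro!: modular_from_generators)
qed

subsection \<open>The Taylor coefficients of \<open>\<Delta>\<close>\<close>

lemma upper_half_plane_E2_star:
  assumes "z \<in> upper_half_plane"
  shows "of_real pi * \<i> / 6 * (z - cnj z) * E2_star z = of_real pi * \<i> / 6 * (z - cnj z) * E2 z + 1"
proof -
  have eq: "z - cnj z = 2 * \<i> * of_real (Im z)" by (simp add: complex_eq_iff)
  have "Im z \<noteq> 0" using assms by (simp add: upper_half_plane_def)
  then have "of_real pi * \<i> / 6 * (2 * \<i> * of_real (Im z)) * (3 / of_real (pi * Im z)) = - 1"
    by simp
  then show ?thesis
    unfolding eq E2_star_def right_diff_distrib by simp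
qed

lemma taylor_coeff12_Delta:
  assumes z: "z \<in> upper_half_plane"
  shows "taylor_coeff12 z Delta m =
    Delta z * (of_real pi * \<i> / 6) ^ m * (z - cnj z) ^ (m + 6) *
    (\<Sum>r=0..m. 1 / fact r * of_nat ((m + 11) choose (r + 11)) * E2_star z ^ (m - r) * calB r z)"
proof -
  define \<kappa> Y where "\<kappa> = of_real pi * \<i> / 6" and "Y = z - cnj z"
  define u where "u = \<kappa> * Y"
  have u: "u * E2 z + 1 = u * E2_star z"
    using upper_half_plane_E2_star[OF z] by (simp only: u_def \<kappa>_def Y_def)
  have "(\<Sum>j\<le>m. laguerre_coeff m j * (Y ^ j * (deriv ^^ j) Delta z)) =
      Delta z * (\<Sum>j\<le>m. laguerre_coeff m j * (u ^ j * (\<Sum>r\<le>j. laguerre_coeff j r * (E2 z ^ (j - r) * calB r z))))"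
    unfolding higher_deriv_Delta[OF z]
    by (subst sum_distrib_left, intro sum.cong refl) (simp only: u_def \<kappa>_def power_mult_distrib mult_ac)
  also have "\<dots> = Delta z * (\<Sum>r\<le>m. laguerre_coeff m r * (u ^ r * (u * E2_star z) ^ (m - r) * calB r z))"
    unfolding laguerre_coeff_double_sum u ..
  also have "(\<Sum>r\<le>m. laguerre_coeff m r * (u ^ r * (u * E2_star z) ^ (m - r) * calB r z)) =
      fact m * u ^ m * (\<Sum>r=0..m. 1 / fact r * of_nat ((m + 11) choose (r + 11)) * E2_star z ^ (m - r) * calB r z)"
    unfolding sum_distrib_left atMost_atLeast0
  proof (rule sum.cong[OF refl])
    fix r assume "r \<in> {0..m}"
    \<comment> \<open>Replacing \<open>u * E2 z + 1\<close> by \<open>u * E2_star z\<close> makes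
      every summand homogeneous of degree \<open>m\<close> in \<open>u\<close>, so
      \<open>u ^ m\<close> factors out.\<close>
    then have "u ^ m = u ^ r * u ^ (m - r)" by (simp flip: power_add)
    then show "laguerre_coeff m r * (u ^ r * (u * E2_star z) ^ (m - r) * calB r z) =
        fact m * u ^ m * (1 / fact r * of_nat ((m + 11) choose (r + 11)) * E2_star z ^ (m - r) * calB r z)"
      by (simp add: laguerre_coeff_def power_mult_distrib)
  qed
  finally show ?thesis
    unfolding taylor_coeff12_eq[OF Delta_holomorphic z] Y_def[symmetric] \<kappa>_def[symmetric]
    by (simp add: u_def power_mult_distrib power_add)
qed

theorem theorem4p1:
  shows "(\<forall>r. calB r \<in> modular_forms (2 * r)) \<and>
    (\<forall>m::nat. \<forall>z\<in>upper_half_plane.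
       taylor_coeff12 z Delta m =
         Delta z * (of_real pi * \<i> / 6) ^ m * (z - cnj z) ^ (m + 6) *
         (\<Sum>r=0..m. 1 / fact r * of_nat ((m + 11) choose (r + 11)) *
            E2_star z ^ (m - r) * calB r z))"
  using calB_modular_form taylor_coeff12_Delta by blast

end
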